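(* Let $\delta,\gamma$ be fixed parameters with $0<\delta<1/13$ and $0<\gamma<1$, let $s\ge1$ be an integer, and let $\{\Psi_\nu\}_{\nu\in\mathcal{J}}$ be a (bounded) orthonormal system in $L^2(\mathcal{U},d\varrho)$, indexed by a finite set $\mathcal{J}\subset\mathbb{N}_0^d$ of size $N=\#(\mathcal{J})$ that contains at least one lower set of cardinality $s$. Assume that the integer $m$ satisfies $$m\ \ge\ 2^6 e\,\frac{K(s)}{\delta^2}\log\Big(\frac{K(s)}{\delta^2}\Big)\max\left\{\frac{2^5}{\delta^4}\log\Big(40\,\frac{K(s)}{\delta^2}\log\Big(\frac{K(s)}{\delta^2}\Big)\Big)\log(4N),\ \frac1\delta\log\Big(\frac{1}{\gamma\delta}\log\Big(\frac{K(s)}{\delta^2}\Big)\Big)\right\},$$ and that $y_1,\dots,y_m$ are drawn independently from the orthogonalization measure $\varrho$ associated to $\{\Psi_\nu\}$. Then, with probability exceeding $1-\gamma$, the normalized sampling matrix $A\in\mathbb{C}^{m\times N}$ satisfies $$(1-13\delta)\|z\|_2^2<\|Az\|_2^2<(1+13\delta)\|z\|_2^2$$ for all nonzero $z\in\mathbb{C}^N$ with $K(\mathrm{supp}(z))\le K(s)$.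
   Context: $\mathcal{U}=\prod_{k=1}^d\mathcal{U}_k\subset\mathbb{R}^d$ is a compact product domain equipped with a probability measure $\varrho$; $\mathcal{J}=\{\nu_1,\dots,\nu_N\}\subset\mathbb{N}_0^d$; the functions $\Psi_\nu:\mathcal{U}\to\mathbb{C}$, $\nu\in\mathcal{J}$, are orthonormal in $L^2(\mathcal{U},d\varrho)$ and bounded. A set $\Lambda\subset\mathbb{N}_0^d$ is a lower set (downward closed) if $\nu\in\Lambda$ and $\mu\le\nu$ (i.e. $\mu_k\le\nu_k$ for all $1\le k\le d$) imply $\mu\in\Lambda$. For a set $\Lambda$ of multi-indices, $$K(\Lambda):=\Big\|\sum_{\nu\in\Lambda}|\Psi_\nu|^2\Big\|_{L^\infty(\mathcal{U})},$$ and, with an abuse of notation, for an integer $s$, $$K(s):=\sup\{K(\Lambda):\ \Lambda\subset\mathcal{J},\ \Lambda\text{ lower},\ \#(\Lambda)=s\}.$$ The normalized sampling matrix associated with $y_1,\dots,y_m$ is $A=\big(\Psi_{\nu_j}(y_i)/\sqrt m\big)_{1\le i\le m,\,1\le j\le N}$. Vectors $z\in\mathbb{C}^N$ are indexed by $\mathcal{J}$, and $\mathrm{supp}(z)\subset\mathcal{J}$ is the set of multi-indices of nonzero entries. $\log$ is the natural logarithm. *)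

theory Defs
  imports "HOL-Probability.Probability"
begin

text \<open>Multi-indices in \<open>\<nat>\<^sub>0\<^sup>d\<close> are functions \<open>'d \<Rightarrow> nat\<close> on a finite
  type \<open>'d\<close> with \<open>d = CARD('d)\<close>; the order \<open>\<le>\<close> on them is the componentwise one.\<close>

definition lower_set :: "('d::finite \<Rightarrow> nat) set \<Rightarrow> bool" where
  "lower_set \<Lambda> \<longleftrightarrow> (\<forall>\<nu>\<in>\<Lambda>. \<forall>\<mu>. \<mu> \<le> \<nu> \<longrightarrow> \<mu> \<in> \<Lambda>)"

definition orthonormal_system :: "'u measure \<Rightarrow> 'i set \<Rightarrow> ('i \<Rightarrow> 'u \<Rightarrow> complex) \<Rightarrow> bool" where
  "orthonormal_system \<rho> J \<Psi> \<longleftrightarrow>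
     (\<forall>\<nu>\<in>J. \<Psi> \<nu> \<in> borel_measurable \<rho> \<and> integrable \<rho> (\<lambda>x. (cmod (\<Psi> \<nu> x))\<^sup>2)) \<and>
     (\<forall>\<nu>\<in>J. \<forall>\<mu>\<in>J. (LINT x|\<rho>. \<Psi> \<nu> x * cnj (\<Psi> \<mu> x)) = (if \<nu> = \<mu> then 1 else 0))"

text \<open>The \<open>L\<^sup>\<infinity>\<close> norm is the essential supremum with respect to \<open>\<rho>\<close>.  The
  conversion to \<open>real\<close> is meaningful for essentially bounded measurable \<open>f\<close> only:
  for other \<open>f\<close> the norm is infinite and \<^const>\<open>real_of_ereal\<close> returns \<open>0\<close>.\<close>

definition Linf_norm :: "'u measure \<Rightarrow> ('u \<Rightarrow> real) \<Rightarrow> real" where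
  "Linf_norm \<rho> f = real_of_ereal (esssup \<rho> (\<lambda>x. ereal \<bar>f x\<bar>))"

definition K_set :: "'u measure \<Rightarrow> ('i \<Rightarrow> 'u \<Rightarrow> complex) \<Rightarrow> 'i set \<Rightarrow> real" where
  "K_set \<rho> \<Psi> \<Lambda> = Linf_norm \<rho> (\<lambda>x. \<Sum>\<nu>\<in>\<Lambda>. (cmod (\<Psi> \<nu> x))\<^sup>2)"

text \<open>For finite \<open>J\<close> this is a supremum over a finite family; it is unspecified when
  \<open>J\<close> contains no lower set of cardinality \<open>s\<close>.\<close>

definition K_card ::
  "'u measure \<Rightarrow> ('d::finite \<Rightarrow> nat) set \<Rightarrow> (('d \<Rightarrow> nat) \<Rightarrow> 'u \<Rightarrow> complex) \<Rightarrow> nat \<Rightarrow> real" where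
  "K_card \<rho> J \<Psi> s = (SUP \<Lambda>\<in>{\<Lambda>. \<Lambda> \<subseteq> J \<and> lower_set \<Lambda> \<and> card \<Lambda> = s}. K_set \<rho> \<Psi> \<Lambda>)"

text \<open>Columns of matrices and entries of vectors are indexed by the elements of \<open>J\<close>
  directly; values of a vector outside \<open>J\<close> are irrelevant.\<close>

definition sampling_matrix ::
  "('i \<Rightarrow> 'u \<Rightarrow> complex) \<Rightarrow> nat \<Rightarrow> (nat \<Rightarrow> 'u) \<Rightarrow> nat \<Rightarrow> 'i \<Rightarrow> complex" where
  "sampling_matrix \<Psi> m y i \<nu> = \<Psi> \<nu> (y i) / of_real (sqrt (real m))"

definition mat_vec :: "'i set \<Rightarrow> (nat \<Rightarrow> 'i \<Rightarrow> complex) \<Rightarrow> ('i \<Rightarrow> complex) \<Rightarrow> nat \<Rightarrow> complex" where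
  "mat_vec J A z i = (\<Sum>\<nu>\<in>J. A i \<nu> * z \<nu>)"

definition vec_supp :: "'i set \<Rightarrow> ('i \<Rightarrow> complex) \<Rightarrow> 'i set" where
  "vec_supp J z = {\<nu>\<in>J. z \<nu> \<noteq> 0}"

definition l2_norm :: "'i set \<Rightarrow> ('i \<Rightarrow> complex) \<Rightarrow> real" where
  "l2_norm I z = L2_set (\<lambda>i. cmod (z i)) I"

end

theory Submission
  imports Defs
begin

text \<open>For a unit vector \<open>z\<close> let \<open>F = |\<Sum>\<^sub>\<nu> z\<^sub>\<nu> \<Psi>\<^sub>\<nu>|\<^sup>2\<close>; then \<open>F \<le> K\<close> almost everywhere and \<open>\<integral>F d\<rho> = 1\<close>, and the
  empirical mean of \<open>F\<close> has to be close to \<open>1\<close> uniformly in \<open>z\<close>.  The layer cake formula with the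
  levels \<open>t\<^sub>j = \<delta> (1 + \<delta>)\<^sup>j\<close> reduces this to the superlevel sets \<open>{F \<ge> t\<^sub>j}\<close>.  Such a set is
  replaced by a majority vote of \<open>q \<approx> log K\<close> independent sparse approximations of the vector \<open>z\<close>,
  each an average of \<open>n\<^sub>j \<approx> K / (\<delta>\<^sup>2 t\<^sub>j)\<close> random atoms.  The atoms are chosen so that the variance
  is bounded by \<open>\<Sum>\<^bsub>\<nu>\<in>supp z\<^esub> |\<Psi>\<^sub>\<nu>|\<^sup>2 \<le> K\<close> at every point; the vote turns Chebyshev's
  inequality into an exponentially small error, and by the probabilistic argument one vote is
  accurate for \<open>\<rho>\<close> and for the empirical measure at the same time.  Only \<open>(4N)\<^bsup>O(n\<^sub>j q)\<^esup>\<close> votes exist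
  at level \<open>j\<close>, so a Chernoff bound at precision \<open>u\<^sub>j \<approx> \<delta> / (t\<^sub>j log (K / \<delta>\<^sup>2))\<close> and a union bound
  over all votes and levels finish the proof.\<close>

section \<open>Second moments and majorities of independent samples\<close>

text \<open>The hypothesis controls only the sum of \<open>|\<Psi> \<nu>|^2\<close> over the
  support. Drawing \<nu> with probability proportional to \<open>|z \<nu>|\<close>, as in Maurey's
  method, would bring in the l1 norm of z and the sup norms of single functions; probabilities of
  order \<open>|z \<nu>|^2\<close> bring in exactly the controlled sum. An error set can weigh up to
  K in the layer sum, so its measure must be of order \<delta> / K. A longer average would pay for
  this with a factor K / \<delta> in its length, the vote pays with a logarithm. The Chernoff bound
  is taken with an error of the form \<open>\<delta> * p + u\<close>: its exponent is linear in u,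
  and the parts \<open>\<delta> * p\<close> add up over the levels to \<delta> times a quantity
  close to the integral of F. Since the entropy of the votes and the admissible u are both inversely
  proportional to the level, one m serves all levels. Finally, the event in question is an
  intersection over uncountably many z, so its measurability needs an argument of its own.\<close>

lemma finite_set_replicate_pmf:
  "finite (set_pmf p) \<Longrightarrow> finite (set_pmf (replicate_pmf n p))"
  by (simp add: set_replicate_pmf finite_lists_length_eq lists_eq_set)

lemma expectation_replicate_pmf_Suc:
  fixes h :: "'a list \<Rightarrow> 'b::{banach, second_countable_topology}"
  assumes "finite (set_pmf p)"
  shows "measure_pmf.expectation (replicate_pmf (Suc n) p) h =
    measure_pmf.expectation p (\<lambda>x. measure_pmf.expectation (replicate_pmf n p) (\<lambda>xs. h (x # xs)))"
proof -
  have "measure_pmf.expectation (replicate_pmf (Suc n) p) h =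
    (\<Sum>x\<in>set_pmf p. pmf p x *\<^sub>R
       measure_pmf.expectation (map_pmf ((#) x) (replicate_pmf n p)) h)"
    using assms finite_set_replicate_pmf[OF assms]
    by (simp add: pmf_expectation_bind[of "set_pmf p"] map_pmf_def[symmetric])
  also have "\<dots> = measure_pmf.expectation p
      (\<lambda>x. measure_pmf.expectation (replicate_pmf n p) (\<lambda>xs. h (x # xs)))"
    by (simp add: integral_measure_pmf[OF assms])
  finally show ?thesis .
qed

text \<open>Variances of independent draws add because the cross terms vanish, and a variance is at
  most the second moment. Complex numbers are treated as plane vectors, so that the cross term is a
  real inner product.\<close>

lemma replicate_pmf_sum_variance:
  fixes f :: "'a \<Rightarrow> complex"
  assumes fin: "finite (set_pmf p)"
    and mean: "measure_pmf.expectation p f = w"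
    and second: "measure_pmf.expectation p (\<lambda>a. (cmod (f a))\<^sup>2) \<le> B"
  shows "measure_pmf.expectation (replicate_pmf n p)
           (\<lambda>xs. (cmod ((\<Sum>a\<leftarrow>xs. f a) - of_nat n * w))\<^sup>2) \<le> real n * B"
proof -
  have int: "integrable (measure_pmf p) g" for g :: "'a \<Rightarrow> 'c::{banach, second_countable_topology}"
    by (rule integrable_measure_pmf_finite[OF fin])
  have intr: "integrable (measure_pmf (replicate_pmf k p)) g"
    for k and g :: "'a list \<Rightarrow> 'c::{banach, second_countable_topology}"
    by (rule integrable_measure_pmf_finite[OF finite_set_replicate_pmf[OF fin]])
  have m0: "measure_pmf.expectation (replicate_pmf n p) (\<lambda>xs. (\<Sum>a\<leftarrow>xs. f a) - of_nat n * w) = 0" for n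
  proof (induction n)
    case (Suc n)
    have eq: "(\<Sum>a\<leftarrow>x # xs. f a) - of_nat (Suc n) * w = (f x - w) + ((\<Sum>a\<leftarrow>xs. f a) - of_nat n * w)" for x xs
      by (simp add: algebra_simps)
    show ?case
      unfolding expectation_replicate_pmf_Suc[OF fin] eq
      by (simp only: Bochner_Integration.integral_add[OF intr intr] Suc)
         (simp add: Bochner_Integration.integral_diff[OF int int] mean)
  qed simp
  have var: "measure_pmf.expectation p (\<lambda>a. (cmod (f a - w))\<^sup>2) \<le> B"
  proof -
    have eq: "(cmod (f a - w))\<^sup>2 = (cmod (f a))\<^sup>2 - 2 * (f a \<bullet> w) + (cmod w)\<^sup>2" for a
      by (simp add: power2_norm_eq_inner inner_diff inner_commute algebra_simps)
    have "measure_pmf.expectation p (\<lambda>a. f a \<bullet> w) = w \<bullet> w"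
      by (subst integral_inner_left) (use int mean in auto)
    then have "measure_pmf.expectation p (\<lambda>a. (cmod (f a - w))\<^sup>2) =
      measure_pmf.expectation p (\<lambda>a. (cmod (f a))\<^sup>2) - (cmod w)\<^sup>2"
      unfolding eq
      by (simp add: Bochner_Integration.integral_diff[OF int int] Bochner_Integration.integral_add[OF int int]
          power2_norm_eq_inner)
    also have "\<dots> \<le> B" using second by (smt (verit) zero_le_power2)
    finally show ?thesis .
  qed
  show "measure_pmf.expectation (replicate_pmf n p)
           (\<lambda>xs. (cmod ((\<Sum>a\<leftarrow>xs. f a) - of_nat n * w))\<^sup>2) \<le> real n * B"
  proof (induction n)
    case (Suc n)
    let ?S = "\<lambda>xs. (\<Sum>a\<leftarrow>xs. f a) - of_nat n * w"
    have eq: "(cmod ((\<Sum>a\<leftarrow>x # xs. f a) - of_nat (Suc n) * w))\<^sup>2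
       = (cmod (f x - w))\<^sup>2 + 2 * (?S xs \<bullet> (f x - w)) + (cmod (?S xs))\<^sup>2" for x xs
    proof -
      have "(\<Sum>a\<leftarrow>x # xs. f a) - of_nat (Suc n) * w = (f x - w) + ?S xs"
        by (simp add: algebra_simps)
      then show ?thesis
        by (simp only:) (simp only: power2_norm_eq_inner inner_add inner_commute algebra_simps mult_2)
    qed
    have cross: "measure_pmf.expectation (replicate_pmf n p) (\<lambda>xs. ?S xs \<bullet> c) = 0" for c
      by (subst integral_inner_left) (use intr m0 in auto)
    have "measure_pmf.expectation (replicate_pmf (Suc n) p)
           (\<lambda>xs. (cmod ((\<Sum>a\<leftarrow>xs. f a) - of_nat (Suc n) * w))\<^sup>2)
        = measure_pmf.expectation p (\<lambda>x. (cmod (f x - w))\<^sup>2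
            + measure_pmf.expectation (replicate_pmf n p) (\<lambda>xs. (cmod (?S xs))\<^sup>2))"
      unfolding expectation_replicate_pmf_Suc[OF fin] eq
      by (simp only: Bochner_Integration.integral_add[OF intr intr] integral_mult_right_zero cross) simp
    also have "\<dots> \<le> B + real n * B"
      using var Suc by (simp add: Bochner_Integration.integral_add[OF int int])
    finally show ?case by (simp add: algebra_simps)
  qed simp
qed

lemma replicate_pmf_chebyshev:
  fixes f :: "'a \<Rightarrow> complex"
  assumes fin: "finite (set_pmf p)"
    and mean: "measure_pmf.expectation p f = w"
    and second: "measure_pmf.expectation p (\<lambda>a. (cmod (f a))\<^sup>2) \<le> B"
    and "0 < \<sigma>"
  shows "measure_pmf.prob (replicate_pmf n p) {xs. \<sigma> \<le> cmod ((\<Sum>a\<leftarrow>xs. f a) - of_nat n * w)}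
         \<le> real n * B / \<sigma>\<^sup>2"
proof -
  have "{xs. \<sigma> \<le> cmod ((\<Sum>a\<leftarrow>xs. f a) - of_nat n * w)}
     = {xs \<in> space (replicate_pmf n p). \<sigma>\<^sup>2 \<le> (cmod ((\<Sum>a\<leftarrow>xs. f a) - of_nat n * w))\<^sup>2}"
    using \<open>0 < \<sigma>\<close> by (auto intro: power_mono dest: power2_le_imp_le)
  also have "measure_pmf.prob (replicate_pmf n p) \<dots>
     \<le> measure_pmf.expectation (replicate_pmf n p) (\<lambda>xs. (cmod ((\<Sum>a\<leftarrow>xs. f a) - of_nat n * w))\<^sup>2) / \<sigma>\<^sup>2"
    using \<open>0 < \<sigma>\<close>
    by (intro integral_Markov_inequality_measure[where A = "{}"])
       (auto intro: integrable_measure_pmf_finite finite_set_replicate_pmf[OF fin])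
  also have "\<dots> \<le> real n * B / \<sigma>\<^sup>2"
    using replicate_pmf_sum_variance[OF fin mean second] by (intro divide_right_mono) auto
  finally show ?thesis .
qed

lemma expectation_replicate_pmf_power_filter:
  fixes c :: real
  assumes fin: "finite (set_pmf p)"
  shows "measure_pmf.expectation (replicate_pmf q p) (\<lambda>xs. c ^ length (filter Q xs))
         = (1 + (c - 1) * measure_pmf.prob p {x. Q x}) ^ q"
proof (induction q)
  case (Suc q)
  have int: "integrable (measure_pmf p) g" for g :: "'a \<Rightarrow> real"
    by (rule integrable_measure_pmf_finite[OF fin])
  let ?E = "measure_pmf.expectation (replicate_pmf q p) (\<lambda>xs. c ^ length (filter Q xs))"
  have "measure_pmf.expectation (replicate_pmf (Suc q) p) (\<lambda>xs. c ^ length (filter Q xs))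
     = measure_pmf.expectation p (\<lambda>x. (1 + (c - 1) * indicator {x. Q x} x) * ?E)"
    unfolding expectation_replicate_pmf_Suc[OF fin]
    by (intro Bochner_Integration.integral_cong refl) (auto simp: indicator_def)
  also have "\<dots> = (1 + (c - 1) * measure_pmf.prob p {x. Q x}) * ?E"
    by (simp add: Bochner_Integration.integral_add[OF int int])
  finally show ?case using Suc by simp
qed simp

text \<open>An exponential Markov inequality for \<open>36 ^ #Q\<close>; the threshold is \<open>36 ^ (q / 2) = 6 ^ q\<close>.\<close>

lemma replicate_pmf_majority:
  assumes fin: "finite (set_pmf p)"
    and small: "measure_pmf.prob p {x. Q x} \<le> 1 / 36"
  shows "measure_pmf.prob (replicate_pmf q p) {xs. length xs \<le> 2 * length (filter Q xs)} \<le> (1 / 3) ^ q"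
proof -
  have eq: "measure_pmf.prob (replicate_pmf q p) {xs. length xs \<le> 2 * length (filter Q xs)}
     = measure_pmf.prob (replicate_pmf q p) {xs. q \<le> 2 * length (filter Q xs)}"
    by (intro measure_pmf.finite_measure_eq_AE) (auto simp: AE_measure_pmf_iff set_replicate_pmf)
  have "{xs. q \<le> 2 * length (filter Q xs)}
     \<subseteq> {xs \<in> space (replicate_pmf q p). 6 ^ q \<le> (36::real) ^ length (filter Q xs)}"
  proof safe
    fix xs assume "q \<le> 2 * length (filter Q xs)"
    then have "(6::real) ^ q \<le> 6 ^ (2 * length (filter Q xs))" by (intro power_increasing) auto
    then show "6 ^ q \<le> (36::real) ^ length (filter Q xs)" by (simp add: power_mult)
  qed simp
  then have "measure_pmf.prob (replicate_pmf q p) {xs. q \<le> 2 * length (filter Q xs)}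
     \<le> measure_pmf.prob (replicate_pmf q p) {xs \<in> space (replicate_pmf q p). 6 ^ q \<le> (36::real) ^ length (filter Q xs)}"
    by (intro measure_pmf.finite_measure_mono) auto
  also have "\<dots> \<le> measure_pmf.expectation (replicate_pmf q p) (\<lambda>xs. 36 ^ length (filter Q xs)) / 6 ^ q"
    by (intro integral_Markov_inequality_measure[where A = "{}"])
       (auto intro: integrable_measure_pmf_finite finite_set_replicate_pmf[OF fin])
  also have "\<dots> = (1 + 35 * measure_pmf.prob p {x. Q x}) ^ q / 6 ^ q"
    by (simp add: expectation_replicate_pmf_power_filter[OF fin])
  also have "\<dots> \<le> 2 ^ q / 6 ^ q"
    using small by (intro divide_right_mono power_mono) auto
  also have "\<dots> = (1 / 3) ^ q" by (simp flip: power_divide)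
  finally show ?thesis unfolding eq .
qed

section \<open>Random atoms whose mean is a given vector\<close>

lemma pmf_of_finite_weights:
  fixes w :: "'a \<Rightarrow> real"
  assumes "finite A" "\<And>x. x \<in> A \<Longrightarrow> 0 \<le> w x" "sum w A = 1"
  obtains p where "set_pmf p \<subseteq> A" "\<And>x. x \<in> A \<Longrightarrow> pmf p x = w x"
proof
  let ?w = "\<lambda>x. if x \<in> A then w x else 0"
  have nonneg: "\<And>x. 0 \<le> ?w x" using assms by auto
  have "(\<integral>\<^sup>+x. ennreal (?w x) \<partial>count_space UNIV) = (\<Sum>x\<in>A. ennreal (?w x))"
    using assms(1) by (intro nn_integral_count_space') auto
  also have "\<dots> = 1" using assms by (simp add: sum_ennreal)
  finally have one: "(\<integral>\<^sup>+x. ennreal (?w x) \<partial>count_space UNIV) = 1" .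
  show "set_pmf (embed_pmf ?w) \<subseteq> A" by (auto simp: set_embed_pmf[OF nonneg one])
  show "pmf (embed_pmf ?w) x = w x" if "x \<in> A" for x
    using that by (simp add: pmf_embed_pmf[OF nonneg one])
qed

text \<open>With the four units, real and imaginary parts of either sign are reproduced by positive
  weights. The value \<open>r = 0\<close> supplies a zero coefficient, which takes up the mass left
  over when the other weights sum to less than 1.\<close>

definition coeffs :: "nat \<Rightarrow> complex set" where
  "coeffs N = (\<lambda>(r, u). of_nat (3 * r) * u) ` ({..N} \<times> {1, -1, \<i>, -\<i>})"

lemma finite_coeffs [simp]: "finite (coeffs N)"
  by (simp add: coeffs_def)

lemma card_coeffs_le: "card (coeffs N) \<le> 4 * (N + 1)"
proof -
  have "card (coeffs N) \<le> card ({..N} \<times> {1, -1, \<i>, -\<i>})"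
    unfolding coeffs_def by (intro card_image_le) auto
  also have "\<dots> = (N + 1) * card {1, -1, \<i>, -\<i>}" by (simp add: card_cartesian_product)
  also have "\<dots> \<le> (N + 1) * 4" by (intro mult_left_mono card_insert_le_m1) auto
  finally show ?thesis by simp
qed

text \<open>\<open>3 / 2\<close> is a rational substitute for the sharp constant, the square root of
  2. After squaring, the claim is \<open>8 * a * b \<le> 5 * (a^2 + b^2)\<close>.\<close>

lemma norm1_le_cmod: "\<bar>Re z\<bar> + \<bar>Im z\<bar> \<le> 3 / 2 * cmod z"
proof (rule power2_le_imp_le)
  have "2 * (\<bar>Re z\<bar> * \<bar>Im z\<bar>) \<le> (Re z)\<^sup>2 + (Im z)\<^sup>2"
    using sum_squares_bound[of "\<bar>Re z\<bar>" "\<bar>Im z\<bar>"] by simp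
  then have "8 * (\<bar>Re z\<bar> * \<bar>Im z\<bar>) \<le> 5 * (Im z)\<^sup>2 + 5 * (Re z)\<^sup>2"
    using zero_le_power2[of "Re z"] zero_le_power2[of "Im z"] by linarith
  then show "(\<bar>Re z\<bar> + \<bar>Im z\<bar>)\<^sup>2 \<le> (3 / 2 * cmod z)\<^sup>2"
    by (simp add: power_mult_distrib power_divide power2_sum cmod_power2)
qed simp

text \<open>Sampling \<open>\<nu>\<close> roughly with probability \<open>|z \<nu>|\<^sup>2\<close> makes the coefficients of size
  \<open>1 / |z \<nu>|\<close>, so that the second moment is bounded by \<open>\<Sum>|g \<nu>|\<^sup>2\<close> pointwise; truncating the
  coefficients at \<open>N\<close> and rounding them up to integers keeps the number of atoms polynomial
  in \<open>N\<close>.\<close>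

lemma atomic_pmf_exists:
  fixes z :: "'i \<Rightarrow> complex"
  assumes J: "finite J" and unit: "(\<Sum>\<nu>\<in>J. (cmod (z \<nu>))\<^sup>2) = 1"
  obtains p :: "('i \<times> complex) pmf" where "set_pmf p \<subseteq> J \<times> coeffs (card J)"
    and "\<And>g. measure_pmf.expectation p (\<lambda>a. snd a * g (fst a)) = (\<Sum>\<nu>\<in>J. g \<nu> * z \<nu>)"
    and "\<And>g. measure_pmf.expectation p (\<lambda>a. (cmod (snd a * g (fst a)))\<^sup>2)
             \<le> 9 * (\<Sum>\<nu>\<in>vec_supp J z. (cmod (g \<nu>))\<^sup>2)"
proof -
  define N where "N = card J"
  have "J \<noteq> {}" using unit by auto
  then have N: "1 \<le> N" using J by (simp add: N_def Suc_leI card_gt_0_iff)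
  \<comment> \<open>The cap at N keeps the set of atoms finite and independent of z. Rounding up,
    not down, gives \<open>1 / r \<nu> \<le> cmod (z \<nu>) + 1 / N\<close>, on which the bound of
    the total mass rests.\<close>
  define r where "r \<nu> = nat \<lceil>1 / max (cmod (z \<nu>)) (1 / N)\<rceil>" for \<nu>
  have z1: "cmod (z \<nu>) \<le> 1" if "\<nu> \<in> J" for \<nu>
  proof -
    have "(cmod (z \<nu>))\<^sup>2 \<le> (\<Sum>\<nu>\<in>J. (cmod (z \<nu>))\<^sup>2)"
      using J that by (intro member_le_sum) auto
    then show ?thesis using unit by (simp add: power_le_one_iff)
  qed
  have maxpos: "0 < max (cmod (z \<nu>)) (1 / N)" for \<nu> using N by (auto simp: max_def)
  have r_ge: "1 / max (cmod (z \<nu>)) (1 / N) \<le> r \<nu>" for \<nu>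
    unfolding r_def by linarith
  have r_le: "r \<nu> \<le> 1 / max (cmod (z \<nu>)) (1 / N) + 1" for \<nu>
    unfolding r_def using maxpos[of \<nu>]
    by (smt (verit, best) ceiling_correct divide_pos_pos of_nat_nat zero_less_ceiling of_int_1)
  have rpos: "0 < r \<nu>" for \<nu>
    using less_le_trans[OF divide_pos_pos[OF zero_less_one maxpos] r_ge] by simp
  have rN: "r \<nu> \<le> N" for \<nu>
  proof -
    have "1 / max (cmod (z \<nu>)) (1 / N) \<le> 1 / (1 / N)"
      using N maxpos[of \<nu>] by (intro divide_left_mono) auto
    then have "1 / max (cmod (z \<nu>)) (1 / N) \<le> real N" by simp
    then have "\<lceil>1 / max (cmod (z \<nu>)) (1 / N)\<rceil> \<le> int N" by linarith
    then show ?thesis by (simp only: r_def nat_le_iff)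
  qed
  have inv_r: "1 / r \<nu> \<le> cmod (z \<nu>) + 1 / N" for \<nu>
  proof -
    have "1 / r \<nu> \<le> max (cmod (z \<nu>)) (1 / N)"
      using r_ge[of \<nu>] maxpos[of \<nu>] rpos[of \<nu>] by (simp add: field_simps)
    then show ?thesis by (smt (verit) norm_ge_zero zero_le_divide_1_iff of_nat_0_le_iff)
  qed
  \<comment> \<open>The capped quotient and the rounding error contribute at most 1 each, the latter
    because \<open>cmod (z \<nu>) \<le> 1\<close>.\<close>
  have rz: "r \<nu> * cmod (z \<nu>) \<le> 2" if "\<nu> \<in> J" for \<nu>
  proof -
    have "r \<nu> * cmod (z \<nu>) \<le> (1 / max (cmod (z \<nu>)) (1 / N) + 1) * cmod (z \<nu>)"
      using r_le by (intro mult_right_mono) auto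
    also have "\<dots> = cmod (z \<nu>) / max (cmod (z \<nu>)) (1 / N) + cmod (z \<nu>)"
      by (simp add: algebra_simps)
    also have "\<dots> \<le> 1 + 1"
      using z1[OF that] maxpos[of \<nu>] by (intro add_mono) (auto simp: divide_le_eq_1)
    finally show ?thesis by simp
  qed
  \<comment> \<open>The mass of the nonzero atoms. The 3 in the denominator reduces
    \<open>3 / 2 * cmod (z \<nu>)\<close> to one half, so that the two contributions, the sum of
    squares and N caps of size \<open>1 / N\<close>, average to 1.\<close>
  define T where "T = (\<Sum>\<nu>\<in>J. (\<bar>Re (z \<nu>)\<bar> + \<bar>Im (z \<nu>)\<bar>) / (3 * r \<nu>))"
  have "T \<le> (\<Sum>\<nu>\<in>J. ((cmod (z \<nu>))\<^sup>2 + 1 / N) / 2)"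
    unfolding T_def
  proof (rule sum_mono)
    fix \<nu> assume "\<nu> \<in> J"
    have "(\<bar>Re (z \<nu>)\<bar> + \<bar>Im (z \<nu>)\<bar>) / (3 * r \<nu>) \<le> (3 / 2 * cmod (z \<nu>)) / (3 * r \<nu>)"
      using norm1_le_cmod by (intro divide_right_mono) auto
    also have "\<dots> = cmod (z \<nu>) * (1 / r \<nu>) / 2" by simp
    also have "\<dots> \<le> cmod (z \<nu>) * (cmod (z \<nu>) + 1 / N) / 2"
      using inv_r by (intro divide_right_mono mult_left_mono) auto
    also have "\<dots> \<le> ((cmod (z \<nu>))\<^sup>2 + 1 / N) / 2"
    proof -
      have "cmod (z \<nu>) * (1 / N) \<le> 1 * (1 / N)"
        using z1[OF \<open>\<nu> \<in> J\<close>] by (intro mult_right_mono) auto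
      then show ?thesis by (simp add: power2_eq_square algebra_simps)
    qed
    finally show "(\<bar>Re (z \<nu>)\<bar> + \<bar>Im (z \<nu>)\<bar>) / (3 * r \<nu>) \<le> ((cmod (z \<nu>))\<^sup>2 + 1 / N) / 2" .
  qed
  also have "\<dots> = 1"
    using unit N by (simp add: sum.distrib flip: sum_divide_distrib N_def)
  finally have T1: "T \<le> 1" .
  \<comment> \<open>For the four units u, \<open>max 0 (Re (z \<nu> * cnj u))\<close> runs through
    the positive and negative parts of the real and imaginary part of \<open>z \<nu>\<close>.
    Division by \<open>3 * r \<nu>\<close> compensates the coefficient that the atom will carry. The
    atoms with \<open>u = 0\<close> share the slack \<open>1 - T\<close> and leave the mean
    unchanged.\<close>
  define w :: "'i \<times> complex \<Rightarrow> real" where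
    "w = (\<lambda>(\<nu>, u). if u = 0 then (1 - T) / N else max 0 (Re (z \<nu> * cnj u)) / (3 * r \<nu>))"
  let ?U = "{0, 1, -1, \<i>, -\<i>} :: complex set"
  have sumU: "(\<Sum>u\<in>?U. h u) = h 0 + h 1 + h (-1) + h \<i> + h (-\<i>)" for h :: "complex \<Rightarrow> 'b::comm_monoid_add"
    by (simp add: complex_eq_iff add.assoc)
  have "sum w (J \<times> ?U) = (\<Sum>\<nu>\<in>J. (1 - T) / N + (\<bar>Re (z \<nu>)\<bar> + \<bar>Im (z \<nu>)\<bar>) / (3 * r \<nu>))"
  proof -
    have "sum w (J \<times> ?U) = (\<Sum>\<nu>\<in>J. \<Sum>u\<in>?U. w (\<nu>, u))"
      by (simp only: sum.cartesian_product) simp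
    also have "\<dots> = (\<Sum>\<nu>\<in>J. (1 - T) / N + (\<bar>Re (z \<nu>)\<bar> + \<bar>Im (z \<nu>)\<bar>) / (3 * r \<nu>))"
      unfolding sumU by (intro sum.cong refl) (auto simp: w_def max_def abs_if add_divide_distrib)
    finally show "sum w (J \<times> ?U) = (\<Sum>\<nu>\<in>J. (1 - T) / N + (\<bar>Re (z \<nu>)\<bar> + \<bar>Im (z \<nu>)\<bar>) / (3 * r \<nu>))" .
  qed
  also have "\<dots> = 1" using N by (simp add: sum.distrib T_def flip: N_def)
  finally have w1: "sum w (J \<times> ?U) = 1" .
  have w0: "0 \<le> w x" for x using T1 by (auto simp: w_def split: prod.split)
  obtain p0 where p0: "set_pmf p0 \<subseteq> J \<times> ?U" "\<And>x. x \<in> J \<times> ?U \<Longrightarrow> pmf p0 x = w x"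
    using pmf_of_finite_weights[of "J \<times> ?U" w] J w0 w1 by blast
  define p where "p = map_pmf (\<lambda>(\<nu>, u). (\<nu>, of_nat (3 * r \<nu>) * u)) p0"
  have E: "measure_pmf.expectation p (\<lambda>a. h (fst a) (snd a)) =
     (\<Sum>\<nu>\<in>J. \<Sum>u\<in>?U. w (\<nu>, u) *\<^sub>R h \<nu> (of_nat (3 * r \<nu>) * u))"
    for h :: "'i \<Rightarrow> complex \<Rightarrow> 'b::{banach, second_countable_topology}"
  proof -
    have "measure_pmf.expectation p (\<lambda>a. h (fst a) (snd a)) =
      (\<Sum>x\<in>J \<times> ?U. pmf p0 x *\<^sub>R h (fst x) (of_nat (3 * r (fst x)) * snd x))"
      unfolding p_def using p0(1) J
      by (subst integral_map_pmf, subst integral_measure_pmf[of "J \<times> ?U"]) (auto simp: case_prod_beta)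
    also have "\<dots> = (\<Sum>x\<in>J \<times> ?U. w x *\<^sub>R h (fst x) (of_nat (3 * r (fst x)) * snd x))"
      using p0(2) by (intro sum.cong) auto
    also have "\<dots> = (\<Sum>\<nu>\<in>J. \<Sum>u\<in>?U. w (\<nu>, u) *\<^sub>R h \<nu> (of_nat (3 * r \<nu>) * u))"
      by (simp only: sum.cartesian_product) (intro sum.cong refl, auto)
    finally show ?thesis .
  qed
  show ?thesis
  proof
    show "set_pmf p \<subseteq> J \<times> coeffs (card J)"
    proof
      fix a assume "a \<in> set_pmf p"
      then obtain \<nu> u where a: "a = (\<nu>, of_nat (3 * r \<nu>) * u)" and \<nu>: "\<nu> \<in> J" and u: "u \<in> ?U"
        using p0(1) by (auto simp: p_def)
      have "of_nat (3 * r \<nu>) * u \<in> coeffs N"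
      proof (cases "u = 0")
        case True
        then show ?thesis unfolding coeffs_def by (intro image_eqI[of _ _ "(0, 1)"]) auto
      next
        case False
        then show ?thesis using u rN[of \<nu>] unfolding coeffs_def
          by (intro image_eqI[of _ _ "(r \<nu>, u)"]) auto
      qed
      then show "a \<in> J \<times> coeffs (card J)" using a \<nu> by (simp add: N_def)
    qed
  next
    fix g :: "'i \<Rightarrow> complex"
    show "measure_pmf.expectation p (\<lambda>a. snd a * g (fst a)) = (\<Sum>\<nu>\<in>J. g \<nu> * z \<nu>)"
      unfolding E[of "\<lambda>\<nu> c. c * g \<nu>"]
    proof (rule sum.cong[OF refl])
      fix \<nu>
      have "(\<Sum>u\<in>?U. w (\<nu>, u) *\<^sub>R (of_nat (3 * r \<nu>) * u * g \<nu>))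
          = (of_real (max 0 (Re (z \<nu>)) - max 0 (- Re (z \<nu>)))
              + \<i> * of_real (max 0 (Im (z \<nu>)) - max 0 (- Im (z \<nu>)))) * g \<nu>"
        unfolding sumU using rpos[of \<nu>]
        by (simp add: w_def scaleR_conv_of_real field_simps)
      also have "max 0 (Re (z \<nu>)) - max 0 (- Re (z \<nu>)) = Re (z \<nu>)" by simp
      also have "max 0 (Im (z \<nu>)) - max 0 (- Im (z \<nu>)) = Im (z \<nu>)" by simp
      also have "(complex_of_real (Re (z \<nu>)) + \<i> * complex_of_real (Im (z \<nu>))) * g \<nu> = g \<nu> * z \<nu>"
        by (simp add: complex_eq[symmetric])
      finally show "(\<Sum>u\<in>?U. w (\<nu>, u) *\<^sub>R (of_nat (3 * r \<nu>) * u * g \<nu>)) = g \<nu> * z \<nu>" .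
    qed
    have "measure_pmf.expectation p (\<lambda>a. (cmod (snd a * g (fst a)))\<^sup>2)
        = (\<Sum>\<nu>\<in>J. 3 * r \<nu> * (\<bar>Re (z \<nu>)\<bar> + \<bar>Im (z \<nu>)\<bar>) * (cmod (g \<nu>))\<^sup>2)"
      unfolding E[of "\<lambda>\<nu> c. (cmod (c * g \<nu>))\<^sup>2"]
    proof (rule sum.cong[OF refl])
      fix \<nu>
      have "(\<Sum>u\<in>?U. w (\<nu>, u) *\<^sub>R (cmod (of_nat (3 * r \<nu>) * u * g \<nu>))\<^sup>2)
         = (max 0 (Re (z \<nu>)) + max 0 (- Re (z \<nu>)) + max 0 (Im (z \<nu>)) + max 0 (- Im (z \<nu>)))
            * (3 * r \<nu>) * (cmod (g \<nu>))\<^sup>2"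
        unfolding sumU using rpos[of \<nu>]
        by (simp add: w_def norm_mult power_mult_distrib power2_eq_square field_simps)
      also have "max 0 (Re (z \<nu>)) + max 0 (- Re (z \<nu>)) + max 0 (Im (z \<nu>)) + max 0 (- Im (z \<nu>))
         = \<bar>Re (z \<nu>)\<bar> + \<bar>Im (z \<nu>)\<bar>" by (simp add: max_def)
      finally show "(\<Sum>u\<in>?U. w (\<nu>, u) *\<^sub>R (cmod (of_nat (3 * r \<nu>) * u * g \<nu>))\<^sup>2)
         = 3 * r \<nu> * (\<bar>Re (z \<nu>)\<bar> + \<bar>Im (z \<nu>)\<bar>) * (cmod (g \<nu>))\<^sup>2" by (simp add: ac_simps)
    qed
    \<comment> \<open>Off the support only the zero coefficient has mass; for this reason the moment
      sees only the functions on the support. The constant is \<open>9 = 3 * (3 / 2) * 2\<close>,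
      from the factor 3, \<open>norm1_le_cmod\<close> and \<open>rz\<close>.\<close>
    also have "\<dots> = (\<Sum>\<nu>\<in>vec_supp J z. 3 * r \<nu> * (\<bar>Re (z \<nu>)\<bar> + \<bar>Im (z \<nu>)\<bar>) * (cmod (g \<nu>))\<^sup>2)"
      using J by (intro sum.mono_neutral_right) (auto simp: vec_supp_def)
    also have "\<dots> \<le> (\<Sum>\<nu>\<in>vec_supp J z. 9 * (cmod (g \<nu>))\<^sup>2)"
    proof (intro sum_mono mult_right_mono)
      fix \<nu> assume "\<nu> \<in> vec_supp J z"
      then have "\<nu> \<in> J" by (simp add: vec_supp_def)
      have "3 * r \<nu> * (\<bar>Re (z \<nu>)\<bar> + \<bar>Im (z \<nu>)\<bar>) \<le> 3 * r \<nu> * (3 / 2 * cmod (z \<nu>))"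
        using norm1_le_cmod by (intro mult_left_mono) auto
      also have "\<dots> \<le> 9" using rz[OF \<open>\<nu> \<in> J\<close>] by simp
      finally show "3 * r \<nu> * (\<bar>Re (z \<nu>)\<bar> + \<bar>Im (z \<nu>)\<bar>) \<le> 9" by simp
    qed simp
    finally show "measure_pmf.expectation p (\<lambda>a. (cmod (snd a * g (fst a)))\<^sup>2)
             \<le> 9 * (\<Sum>\<nu>\<in>vec_supp J z. (cmod (g \<nu>))\<^sup>2)" by (simp add: sum_distrib_left)
  qed
qed

section \<open>Sparse approximation and voting\<close>

text \<open>Left as a sum instead of an average; hence it is compared with
  \<open>of_nat n * lin J \<Psi> z x\<close>, and thresholds carry a factor n.\<close>

definition block :: "('i \<Rightarrow> 'u \<Rightarrow> complex) \<Rightarrow> 'u \<Rightarrow> ('i \<times> complex) list \<Rightarrow> complex" where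
  "block \<Psi> x xs = (\<Sum>a\<leftarrow>xs. snd a * \<Psi> (fst a) x)"

text \<open>A tie counts as a majority. So the negation is strict: if P has no majority, more than
  half of the entries violate P.\<close>

definition majority :: "('b \<Rightarrow> bool) \<Rightarrow> 'b list \<Rightarrow> bool" where
  "majority P cs \<longleftrightarrow> length cs \<le> 2 * length (filter P cs)"

definition vote :: "('i \<Rightarrow> 'u \<Rightarrow> complex) \<Rightarrow> real \<Rightarrow> ('i \<times> complex) list list \<Rightarrow> 'u \<Rightarrow> bool" where
  "vote \<Psi> \<theta> cs x \<longleftrightarrow> majority (\<lambda>xs. \<theta> \<le> cmod (block \<Psi> x xs)) cs"

text \<open>The net for the union bound: it depends on the index set and the lengths, neither on z
  nor on the sample. A code lists only indices and coefficients, so it can be evaluated with any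
  family of functions.\<close>

definition codes :: "'i set \<Rightarrow> nat \<Rightarrow> nat \<Rightarrow> ('i \<times> complex) list list set" where
  "codes J n q = {cs. set cs \<subseteq> {xs. set xs \<subseteq> J \<times> coeffs (card J) \<and> length xs = n} \<and> length cs = q}"

definition lin :: "'i set \<Rightarrow> ('i \<Rightarrow> 'u \<Rightarrow> complex) \<Rightarrow> ('i \<Rightarrow> complex) \<Rightarrow> 'u \<Rightarrow> complex" where
  "lin J \<Psi> z x = (\<Sum>\<nu>\<in>J. \<Psi> \<nu> x * z \<nu>)"

lemma finite_codes: "finite J \<Longrightarrow> finite (codes J n q)"
  unfolding codes_def by (intro finite_lists_length_eq) (auto intro: finite_lists_length_eq)

text \<open>There are at most \<open>N * 4 * (N + 1) \<le> (4 * N)^2\<close> atoms. This is the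
  origin of \<open>ln (4 * N)\<close> in the sample size and of the 2 in the exponent.\<close>

lemma card_codes_le:
  assumes "finite J" "J \<noteq> {}"
  shows "card (codes J n q) \<le> (4 * card J) ^ (2 * (n * q))"
proof -
  have N: "1 \<le> card J" using assms by (simp add: Suc_leI card_gt_0_iff)
  have "card (J \<times> coeffs (card J)) \<le> card J * (4 * (card J + 1))"
    by (simp only: card_cartesian_product) (intro mult_left_mono card_coeffs_le, simp)
  also have "\<dots> \<le> card J * (16 * card J)" using N by (intro mult_left_mono) auto
  finally have atoms: "card (J \<times> coeffs (card J)) \<le> (4 * card J)\<^sup>2"
    by (simp add: power2_eq_square)
  have fin: "finite (J \<times> coeffs (card J))" using assms by simp
  have "card (codes J n q) = (card (J \<times> coeffs (card J)) ^ n) ^ q"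
    unfolding codes_def using fin
    by (simp only: card_lists_length_eq finite_lists_length_eq)
  also have "\<dots> \<le> (((4 * card J)\<^sup>2) ^ n) ^ q" using atoms by (intro power_mono) auto
  finally show ?thesis by (simp only: power_mult mult.assoc)
qed

lemma not_majority_mono:
  assumes "\<not> majority P cs" "\<And>x. x \<in> set cs \<Longrightarrow> Q x \<Longrightarrow> P x"
  shows "\<not> majority Q cs"
proof -
  have "length (filter Q cs) \<le> length (filter P cs)"
    using assms(2) by (induction cs) auto
  then show ?thesis using assms(1) by (simp add: majority_def)
qed

lemma majority_compl:
  assumes "\<not> majority P cs" "\<And>x. x \<in> set cs \<Longrightarrow> \<not> P x \<Longrightarrow> Q x"
  shows "majority Q cs"
proof -
  have "length (filter (\<lambda>x. \<not> P x) cs) \<le> length (filter Q cs)"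
    using assms(2) by (induction cs) auto
  then show ?thesis using assms(1) sum_length_filter_compl[of P cs] by (simp add: majority_def)
qed

text \<open>Deterministic: if fewer than half of the blocks miss w by \<sigma>, the others decide
  the vote. When \<open>cmod w\<close> lies between \<open>\<theta> - \<sigma>\<close> and
  \<open>\<theta> + \<sigma>\<close> either outcome is possible, whence the two thresholds.\<close>

lemma vote_correct:
  assumes "\<not> majority (\<lambda>xs. \<sigma> \<le> cmod (block \<Psi> x xs - w)) cs"
  shows "\<theta> + \<sigma> \<le> cmod w \<Longrightarrow> vote \<Psi> \<theta> cs x" and "vote \<Psi> \<theta> cs x \<Longrightarrow> \<theta> - \<sigma> \<le> cmod w"
proof -
  show "vote \<Psi> \<theta> cs x" if "\<theta> + \<sigma> \<le> cmod w"
    unfolding vote_def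
  proof (rule majority_compl[OF assms])
    fix xs assume "\<not> \<sigma> \<le> cmod (block \<Psi> x xs - w)"
    then show "\<theta> \<le> cmod (block \<Psi> x xs)"
      using that norm_triangle_ineq2[of w "block \<Psi> x xs"] by (simp add: norm_minus_commute)
  qed
  show "\<theta> - \<sigma> \<le> cmod w" if "vote \<Psi> \<theta> cs x"
  proof (rule ccontr)
    assume *: "\<not> \<theta> - \<sigma> \<le> cmod w"
    have "\<not> vote \<Psi> \<theta> cs x"
      unfolding vote_def
    proof (rule not_majority_mono[OF assms])
      fix xs assume "\<theta> \<le> cmod (block \<Psi> x xs)"
      then show "\<sigma> \<le> cmod (block \<Psi> x xs - w)"
        using * norm_triangle_ineq2[of "block \<Psi> x xs" w] by simp
    qed
    then show False using that by simp
  qed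
qed

lemma borel_measurable_length_filter:
  assumes "\<And>xs. xs \<in> set cs \<Longrightarrow> Measurable.pred M (\<lambda>x. P x xs)"
  shows "(\<lambda>x. real (length (filter (P x) cs))) \<in> borel_measurable M"
  using assms
proof (induction cs)
  case (Cons a cs)
  have "(\<lambda>x. real (length (filter (P x) (a # cs))))
      = (\<lambda>x. (if P x a then 1 else 0) + real (length (filter (P x) cs)))" by auto
  also have "\<dots> \<in> borel_measurable M"
    by (intro borel_measurable_add measurable_If Cons borel_measurable_const)
      (use Cons.prems in \<open>auto simp: pred_def\<close>)
  finally show ?case .
qed simp

lemma measurable_majority:
  assumes "\<And>xs. xs \<in> set cs \<Longrightarrow> Measurable.pred M (\<lambda>x. P x xs)"
  shows "Measurable.pred M (\<lambda>x. majority (P x) cs)"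
proof -
  have "(\<lambda>x. real (length (filter (P x) cs))) \<in> borel_measurable M"
    using assms by (rule borel_measurable_length_filter)
  then have "Measurable.pred M (\<lambda>x. real (length cs) \<le> 2 * real (length (filter (P x) cs)))"
    unfolding pred_def by (intro borel_measurable_le borel_measurable_times borel_measurable_const)
  moreover have "majority (P x) cs \<longleftrightarrow> real (length cs) \<le> 2 * real (length (filter (P x) cs))" for x
    unfolding majority_def by linarith
  ultimately show ?thesis by simp
qed

lemma measurable_block:
  assumes "\<And>\<nu>. \<nu> \<in> J \<Longrightarrow> \<Psi> \<nu> \<in> borel_measurable M" "set xs \<subseteq> J \<times> C"
  shows "(\<lambda>x. block \<Psi> x xs) \<in> borel_measurable M"
  using assms(2)
proof (induction xs)
  case (Cons a xs)
  then have "(\<lambda>x. block \<Psi> x xs) \<in> borel_measurable M" by simp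
  moreover have "\<Psi> (fst a) \<in> borel_measurable M" using assms(1) Cons by auto
  ultimately show ?case
    unfolding block_def list.map sum_list.Cons
    by (intro borel_measurable_add borel_measurable_times borel_measurable_const)
qed (simp add: block_def)

lemma measurable_lin:
  assumes "\<And>\<nu>. \<nu> \<in> J \<Longrightarrow> \<Psi> \<nu> \<in> borel_measurable M"
  shows "lin J \<Psi> z \<in> borel_measurable M"
  unfolding lin_def[abs_def] using assms by (intro borel_measurable_sum borel_measurable_times) auto

lemma measurable_vote:
  assumes "\<And>\<nu>. \<nu> \<in> J \<Longrightarrow> \<Psi> \<nu> \<in> borel_measurable M" "cs \<in> codes J n q"
  shows "Measurable.pred M (vote \<Psi> \<theta> cs)"
  unfolding vote_def
proof (rule measurable_majority)
  fix xs assume "xs \<in> set cs"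
  then have "set xs \<subseteq> J \<times> coeffs (card J)" using assms(2) by (auto simp: codes_def)
  then have [measurable]: "(\<lambda>x. block \<Psi> x xs) \<in> borel_measurable M"
    using assms(1) by (intro measurable_block) auto
  show "Measurable.pred M (\<lambda>x. \<theta> \<le> cmod (block \<Psi> x xs))" by measurable
qed

lemma measurable_majority_block:
  assumes "\<And>\<nu>. \<nu> \<in> J \<Longrightarrow> \<Psi> \<nu> \<in> borel_measurable M" "cs \<in> codes J n q" "w \<in> borel_measurable M"
  shows "Measurable.pred M (\<lambda>x. majority (\<lambda>xs. \<sigma> \<le> cmod (block \<Psi> x xs - w x)) cs)"
proof (rule measurable_majority)
  fix xs assume "xs \<in> set cs"
  then have "set xs \<subseteq> J \<times> coeffs (card J)" using assms(2) by (auto simp: codes_def)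
  then have [measurable]: "(\<lambda>x. block \<Psi> x xs) \<in> borel_measurable M"
    using assms(1) by (intro measurable_block) auto
  note [measurable] = assms(3)
  show "Measurable.pred M (\<lambda>x. \<sigma> \<le> cmod (block \<Psi> x xs - w x))" by measurable
qed

text \<open>Fubini for a finite average: the failure probability at a fixed point becomes the
  expected measure of the failure set of a random code.\<close>

lemma pmf_expectation_measure_le:
  fixes p :: "'c pmf" and R :: "'c \<Rightarrow> 'u \<Rightarrow> bool"
  assumes "finite (set_pmf p)" and "prob_space Q"
    and meas: "\<And>c. c \<in> set_pmf p \<Longrightarrow> Measurable.pred Q (R c)"
    and "AE x in Q. measure_pmf.prob p {c. R c x} \<le> \<pi>"
  shows "measure_pmf.expectation p (\<lambda>c. measure Q {x \<in> space Q. R c x}) \<le> \<pi>"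
proof -
  interpret prob_space Q by fact
  have m: "{x \<in> space Q. R c x} \<in> sets Q" if "c \<in> set_pmf p" for c
    using meas[OF that] by measurable
  have fin: "emeasure Q A < \<infinity>" for A by (simp add: less_top[symmetric])
  have "measure_pmf.expectation p (\<lambda>c. measure Q {x \<in> space Q. R c x})
     = (\<Sum>c\<in>set_pmf p. pmf p c * measure Q {x \<in> space Q. R c x})"
    using assms(1) by (simp add: integral_measure_pmf[of "set_pmf p"])
  also have "\<dots> = (\<Sum>c\<in>set_pmf p. LINT x|Q. pmf p c * indicator {x \<in> space Q. R c x} x)"
    by (intro sum.cong refl) (simp add: m)
  also have "\<dots> = (LINT x|Q. (\<Sum>c\<in>set_pmf p. pmf p c * indicator {x \<in> space Q. R c x} x))"
    by (intro Bochner_Integration.integral_sum[symmetric] integrable_mult_right integrable_real_indicator m fin)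
  also have "\<dots> \<le> (LINT x|Q. \<pi>)"
  proof (rule integral_mono_AE)
    show "integrable Q (\<lambda>x. \<Sum>c\<in>set_pmf p. pmf p c * indicator {x \<in> space Q. R c x} x)"
      by (intro Bochner_Integration.integrable_sum integrable_mult_right integrable_real_indicator m fin)
    show "AE x in Q. (\<Sum>c\<in>set_pmf p. pmf p c * indicator {x \<in> space Q. R c x} x) \<le> \<pi>"
      using assms(4) AE_space
    proof eventually_elim
      case (elim x)
      have "measure_pmf.prob p {c. R c x} = measure_pmf.expectation p (indicator {c. R c x})" by simp
      also have "\<dots> = (\<Sum>c\<in>set_pmf p. pmf p c * indicator {c. R c x} c)"
        using assms(1) by (subst integral_measure_pmf[of "set_pmf p"]) auto
      also have "\<dots> = (\<Sum>c\<in>set_pmf p. pmf p c * indicator {x \<in> space Q. R c x} x)"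
        using elim(2) by (intro sum.cong) (auto simp: indicator_def)
      finally show ?case using elim(1) by simp
    qed
  qed simp
  finally show ?thesis by (simp add: prob_space)
qed

text \<open>The first moment method for \<open>a + b\<close>. Averaging a and b separately could
  produce two different codes; the sum costs a factor 2.\<close>

lemma pmf_choose_two:
  fixes a b :: "'c \<Rightarrow> real"
  assumes "finite (set_pmf p)"
    and "measure_pmf.expectation p a \<le> \<pi>" "measure_pmf.expectation p b \<le> \<pi>"
    and "\<And>c. 0 \<le> a c" "\<And>c. 0 \<le> b c"
  obtains c where "c \<in> set_pmf p" "a c \<le> 2 * \<pi>" "b c \<le> 2 * \<pi>"
proof -
  have int: "integrable (measure_pmf p) f" for f :: "'c \<Rightarrow> real"
    by (rule integrable_measure_pmf_finite[OF assms(1)])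
  have "\<exists>c\<in>set_pmf p. a c + b c \<le> 2 * \<pi>"
  proof (rule ccontr)
    assume "\<not> (\<exists>c\<in>set_pmf p. a c + b c \<le> 2 * \<pi>)"
    then have "AE c in measure_pmf p. 2 * \<pi> < a c + b c" by (auto simp: AE_measure_pmf_iff)
    then have "measure_pmf.expectation p (\<lambda>_. 2 * \<pi>) < measure_pmf.expectation p (\<lambda>c. a c + b c)"
      by (intro measure_pmf.integral_less_AE_space int) (auto simp: measure_pmf.emeasure_space_1)
    then show False using assms(2,3) by (simp add: Bochner_Integration.integral_add[OF int int])
  qed
  then obtain c where "c \<in> set_pmf p" "a c + b c \<le> 2 * \<pi>" by blast
  then show ?thesis using that[of c] assms(4,5)[of c] by simp
qed

text \<open>The two families live on unrelated spaces but share the index set and z, so one code can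
  be judged under both. In the application they are \<Psi> under \<rho> and the values at the sample
  points under the uniform distribution of the sample index. \<open>324 = 9 * 36\<close>: the second
  moment of an atom is at most \<open>9 * K\<close>, so Chebyshev bounds the failure of a block by
  \<open>1 / 36\<close>, as the majority estimate requires.\<close>

lemma good_code_exists:
  fixes \<Psi>1 :: "'i \<Rightarrow> 'u \<Rightarrow> complex" and \<Psi>2 :: "'i \<Rightarrow> 'v \<Rightarrow> complex"
  assumes J: "finite J" and unit: "(\<Sum>\<nu>\<in>J. (cmod (z \<nu>))\<^sup>2) = 1"
    and Q1: "prob_space Q1" and Q2: "prob_space Q2"
    and m1: "\<And>\<nu>. \<nu> \<in> J \<Longrightarrow> \<Psi>1 \<nu> \<in> borel_measurable Q1"
    and m2: "\<And>\<nu>. \<nu> \<in> J \<Longrightarrow> \<Psi>2 \<nu> \<in> borel_measurable Q2"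
    and b1: "AE x in Q1. (\<Sum>\<nu>\<in>vec_supp J z. (cmod (\<Psi>1 \<nu> x))\<^sup>2) \<le> K"
    and b2: "AE x in Q2. (\<Sum>\<nu>\<in>vec_supp J z. (cmod (\<Psi>2 \<nu> x))\<^sup>2) \<le> K"
    and \<sigma>: "0 < \<sigma>" "324 * (real n * K) \<le> \<sigma>\<^sup>2"
  obtains cs where "cs \<in> codes J n q"
    and "measure Q1 {x \<in> space Q1. majority (\<lambda>xs. \<sigma> \<le> cmod (block \<Psi>1 x xs - of_nat n * lin J \<Psi>1 z x)) cs} \<le> 2 * (1 / 3) ^ q"
    and "measure Q2 {x \<in> space Q2. majority (\<lambda>xs. \<sigma> \<le> cmod (block \<Psi>2 x xs - of_nat n * lin J \<Psi>2 z x)) cs} \<le> 2 * (1 / 3) ^ q"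
proof -
  obtain p where p: "set_pmf p \<subseteq> J \<times> coeffs (card J)"
    and mean: "\<And>g. measure_pmf.expectation p (\<lambda>a. snd a * g (fst a)) = (\<Sum>\<nu>\<in>J. g \<nu> * z \<nu>)"
    and second: "\<And>g. measure_pmf.expectation p (\<lambda>a. (cmod (snd a * g (fst a)))\<^sup>2)
             \<le> 9 * (\<Sum>\<nu>\<in>vec_supp J z. (cmod (g \<nu>))\<^sup>2)"
    using atomic_pmf_exists[OF J unit] by blast
  have finp: "finite (set_pmf p)" using p J by (meson finite_SigmaI finite_coeffs finite_subset)
  define B where "B = replicate_pmf n p"
  define P where "P = replicate_pmf q B"
  have finB: "finite (set_pmf B)" unfolding B_def by (rule finite_set_replicate_pmf[OF finp])
  have finP: "finite (set_pmf P)" unfolding P_def by (rule finite_set_replicate_pmf[OF finB])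
  have Pcodes: "set_pmf P \<subseteq> codes J n q"
    using p by (fastforce simp: P_def B_def set_replicate_pmf codes_def lists_eq_set)
  have pt: "measure_pmf.prob P {cs. majority (\<lambda>xs. \<sigma> \<le> cmod (block \<Psi> x xs - of_nat n * lin J \<Psi> z x)) cs}
      \<le> (1 / 3) ^ q"
    if bd: "(\<Sum>\<nu>\<in>vec_supp J z. (cmod (\<Psi> \<nu> x))\<^sup>2) \<le> K" for \<Psi> :: "'i \<Rightarrow> 'x \<Rightarrow> complex" and x
    unfolding P_def majority_def
  proof (rule replicate_pmf_majority)
    show "finite (set_pmf B)" by fact
    have "measure_pmf.prob B {xs. \<sigma> \<le> cmod (block \<Psi> x xs - of_nat n * lin J \<Psi> z x)} \<le> real n * (9 * K) / \<sigma>\<^sup>2"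
      unfolding B_def block_def
      by (rule replicate_pmf_chebyshev[OF finp _ _ \<sigma>(1)])
         (use mean[of "\<lambda>\<nu>. \<Psi> \<nu> x"] second[of "\<lambda>\<nu>. \<Psi> \<nu> x"] bd in \<open>auto simp: lin_def\<close>)
    also have "\<dots> \<le> 1 / 36" using \<sigma> by (simp add: divide_le_eq)
    finally show "measure_pmf.prob B {xs. \<sigma> \<le> cmod (block \<Psi> x xs - of_nat n * lin J \<Psi> z x)} \<le> 1 / 36" .
  qed
  let ?R1 = "\<lambda>cs x. majority (\<lambda>xs. \<sigma> \<le> cmod (block \<Psi>1 x xs - of_nat n * lin J \<Psi>1 z x)) cs"
  let ?R2 = "\<lambda>cs x. majority (\<lambda>xs. \<sigma> \<le> cmod (block \<Psi>2 x xs - of_nat n * lin J \<Psi>2 z x)) cs"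
  have e1: "measure_pmf.expectation P (\<lambda>cs. measure Q1 {x \<in> space Q1. ?R1 cs x}) \<le> (1 / 3) ^ q"
  proof (rule pmf_expectation_measure_le[OF finP Q1])
    show "Measurable.pred Q1 (?R1 cs)" if "cs \<in> set_pmf P" for cs
      using that Pcodes m1 by (intro measurable_majority_block[of J]) (auto intro!: measurable_lin borel_measurable_times)
    show "AE x in Q1. measure_pmf.prob P {cs. ?R1 cs x} \<le> (1 / 3) ^ q"
      using b1 by eventually_elim (rule pt)
  qed
  have e2: "measure_pmf.expectation P (\<lambda>cs. measure Q2 {x \<in> space Q2. ?R2 cs x}) \<le> (1 / 3) ^ q"
  proof (rule pmf_expectation_measure_le[OF finP Q2])
    show "Measurable.pred Q2 (?R2 cs)" if "cs \<in> set_pmf P" for cs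
      using that Pcodes m2 by (intro measurable_majority_block[of J]) (auto intro!: measurable_lin borel_measurable_times)
    show "AE x in Q2. measure_pmf.prob P {cs. ?R2 cs x} \<le> (1 / 3) ^ q"
      using b2 by eventually_elim (rule pt)
  qed
  show ?thesis
    by (rule pmf_choose_two[OF finP e1 e2]) (use that Pcodes in \<open>auto simp: subset_iff\<close>)
qed

section \<open>Layer cake decomposition\<close>

definition level :: "real \<Rightarrow> nat \<Rightarrow> real" where
  "level \<delta> j = \<delta> * (1 + \<delta>) ^ j"

text \<open>The increment at index 0 is the whole first level, so that the increments telescope to
  \<open>level\<close>.\<close>

definition level_inc :: "real \<Rightarrow> nat \<Rightarrow> real" where
  "level_inc \<delta> j = (if j = 0 then \<delta> else level \<delta> j - level \<delta> (j - 1))"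

lemma level_Suc: "level \<delta> (Suc j) = (1 + \<delta>) * level \<delta> j"
  by (simp add: level_def)

lemma level_pos: "0 < \<delta> \<Longrightarrow> 0 < level \<delta> j"
  by (simp add: level_def)

lemma level_inc_nonneg: "0 < \<delta> \<Longrightarrow> 0 \<le> level_inc \<delta> j"
  by (cases j) (auto simp: level_inc_def level_Suc algebra_simps less_imp_le[OF level_pos])

lemma sum_level_inc: "(\<Sum>j\<le>J. level_inc \<delta> j) = level \<delta> J"
  by (induction J) (auto simp: level_inc_def level_def)

text \<open>The layer sum is the highest available level not above x, or 0 if there is none. The
  induction needs both alternatives: the step in which the levels overtake x uses the exact value
  \<open>level \<delta> J\<close> from the first. The additive \<delta> covers an x below the lowest
  level.\<close>

lemma layer_sum_cases:
  assumes "0 < \<delta>" "0 \<le> x"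
  defines "S \<equiv> \<lambda>J. \<Sum>j\<le>J. level_inc \<delta> j * of_bool (level \<delta> j \<le> x)"
  shows "(level \<delta> J \<le> x \<longrightarrow> S J = level \<delta> J) \<and> (x < level \<delta> J \<longrightarrow> S J \<le> x \<and> x \<le> (1 + \<delta>) * S J + \<delta>)"
proof (induction J)
  case 0
  then show ?case using assms by (auto simp: S_def level_def level_inc_def)
next
  case (Suc J)
  have SS: "S (Suc J) = S J + level_inc \<delta> (Suc J) * of_bool (level \<delta> (Suc J) \<le> x)"
    unfolding S_def by (rule sum.atMost_Suc)
  have less: "level \<delta> J < level \<delta> (Suc J)" using level_pos[OF assms(1), of J] assms(1)
    by (simp add: level_Suc algebra_simps)
  show ?case
  proof (cases "level \<delta> (Suc J) \<le> x")
    case True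
    then show ?thesis using Suc less SS by (simp add: level_inc_def)
  next
    case False
    then show ?thesis using Suc SS assms(1) level_Suc[of \<delta> J] by (cases "level \<delta> J \<le> x") auto
  qed
qed

lemma layer_sum_le:
  assumes "0 < \<delta>" "0 \<le> x"
  shows "(\<Sum>j\<le>J. level_inc \<delta> j * of_bool (level \<delta> j \<le> x)) \<le> x"
  using layer_sum_cases[OF assms, of J] by linarith

lemma layer_sum_ge:
  assumes "0 < \<delta>" "0 \<le> x" "x < level \<delta> (Suc J)"
  shows "x \<le> (1 + \<delta>) * (\<Sum>j\<le>J. level_inc \<delta> j * of_bool (level \<delta> j \<le> x)) + \<delta>"
proof (cases "level \<delta> J \<le> x")
  case True
  then show ?thesis using layer_sum_cases[OF assms(1,2), of J] assms by (simp add: level_Suc)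
next
  case False
  then show ?thesis using layer_sum_cases[OF assms(1,2), of J] by linarith
qed

text \<open>Where \<open>b j\<close> fails, \<open>h j\<close> lies between the superlevel
  conditions for \<open>F / (1 + \<delta>)^2\<close> and \<open>F / (1 - \<delta>)^2\<close>. Where
  \<open>b j\<close> holds, nothing is known about \<open>h j\<close>, and the increment is charged
  to the sum over b.\<close>

lemma layer_compare_pointwise:
  assumes \<delta>: "0 < \<delta>" "\<delta> < 1" and F: "0 \<le> F" "F < level \<delta> (Suc J)"
    and h: "\<And>j. \<not> b j \<Longrightarrow> level \<delta> j * (1 + \<delta>)\<^sup>2 \<le> F \<Longrightarrow> h j"
           "\<And>j. \<not> b j \<Longrightarrow> h j \<Longrightarrow> level \<delta> j * (1 - \<delta>)\<^sup>2 \<le> F"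
  shows "(\<Sum>j\<le>J. level_inc \<delta> j * of_bool (h j)) \<le> F / (1 - \<delta>)\<^sup>2 + (\<Sum>j\<le>J. level_inc \<delta> j * of_bool (b j))"
    and "F / (1 + \<delta>)\<^sup>2 \<le> (1 + \<delta>) * (\<Sum>j\<le>J. level_inc \<delta> j * of_bool (h j))
            + (1 + \<delta>) * (\<Sum>j\<le>J. level_inc \<delta> j * of_bool (b j)) + \<delta>"
proof -
  have p: "0 < (1 - \<delta>)\<^sup>2" "0 < (1 + \<delta>)\<^sup>2" using \<delta> by auto
  have "(\<Sum>j\<le>J. level_inc \<delta> j * of_bool (h j)) \<le>
     (\<Sum>j\<le>J. level_inc \<delta> j * of_bool (level \<delta> j \<le> F / (1 - \<delta>)\<^sup>2) + level_inc \<delta> j * of_bool (b j))"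
    unfolding distrib_left[symmetric] using h(2) p level_inc_nonneg[OF \<delta>(1)]
    by (intro sum_mono mult_left_mono) (auto simp: of_bool_def pos_le_divide_eq)
  also have "\<dots> \<le> F / (1 - \<delta>)\<^sup>2 + (\<Sum>j\<le>J. level_inc \<delta> j * of_bool (b j))"
    using layer_sum_le[OF \<delta>(1), of "F / (1 - \<delta>)\<^sup>2" J] F by (simp add: sum.distrib)
  finally show "(\<Sum>j\<le>J. level_inc \<delta> j * of_bool (h j)) \<le> F / (1 - \<delta>)\<^sup>2 + (\<Sum>j\<le>J. level_inc \<delta> j * of_bool (b j))" .
  have "F / (1 + \<delta>)\<^sup>2 \<le> F / 1" using \<delta> F by (intro divide_left_mono) auto
  then have "F / (1 + \<delta>)\<^sup>2 \<le> (1 + \<delta>) * (\<Sum>j\<le>J. level_inc \<delta> j * of_bool (level \<delta> j \<le> F / (1 + \<delta>)\<^sup>2)) + \<delta>"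
    using F \<delta> by (intro layer_sum_ge) auto
  also have "(\<Sum>j\<le>J. level_inc \<delta> j * of_bool (level \<delta> j \<le> F / (1 + \<delta>)\<^sup>2)) \<le>
     (\<Sum>j\<le>J. level_inc \<delta> j * of_bool (h j) + level_inc \<delta> j * of_bool (b j))"
    unfolding distrib_left[symmetric] using h(1) p level_inc_nonneg[OF \<delta>(1)]
    by (intro sum_mono mult_left_mono) (auto simp: of_bool_def pos_le_divide_eq)
  finally show "F / (1 + \<delta>)\<^sup>2 \<le> (1 + \<delta>) * (\<Sum>j\<le>J. level_inc \<delta> j * of_bool (h j))
            + (1 + \<delta>) * (\<Sum>j\<le>J. level_inc \<delta> j * of_bool (b j)) + \<delta>"
    using \<delta> by (simp add: sum.distrib distrib_left)
qed

lemma (in prob_space) integral_layer_sum: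
  assumes "\<And>j. j \<le> J \<Longrightarrow> Measurable.pred M (h j)"
  shows "integrable M (\<lambda>x. \<Sum>j\<le>J. c j * of_bool (h j x))"
    and "(LINT x|M. (\<Sum>j\<le>J. c j * of_bool (h j x))) = (\<Sum>j\<le>J. c j * measure M {x \<in> space M. h j x})"
proof -
  have m: "{x \<in> space M. h j x} \<in> sets M" if "j \<le> J" for j
    using assms[OF that] by measurable
  have fin: "emeasure M A < \<infinity>" for A by (simp add: less_top[symmetric])
  have eq: "(\<Sum>j\<le>J. c j * of_bool (h j x)) = (\<Sum>j\<le>J. c j * indicator {x \<in> space M. h j x} x)"
    if "x \<in> space M" for x
    using that by (intro sum.cong) (auto simp: indicator_def)
  have int: "integrable M (\<lambda>x. c j * indicator {x \<in> space M. h j x} x :: real)" if "j \<le> J" for j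
    using that by (intro integrable_mult_right integrable_real_indicator m fin)
  have "integrable M (\<lambda>x. \<Sum>j\<le>J. c j * indicator {x \<in> space M. h j x} x)"
    using int by (intro Bochner_Integration.integrable_sum) auto
  then show "integrable M (\<lambda>x. \<Sum>j\<le>J. c j * of_bool (h j x))"
    using eq by (simp cong: Bochner_Integration.integrable_cong)
  have "(LINT x|M. (\<Sum>j\<le>J. c j * of_bool (h j x))) = (LINT x|M. (\<Sum>j\<le>J. c j * indicator {x \<in> space M. h j x} x))"
    using eq by (intro Bochner_Integration.integral_cong) auto
  also have "\<dots> = (\<Sum>j\<le>J. LINT x|M. c j * indicator {x \<in> space M. h j x} x)"
    using int by (intro Bochner_Integration.integral_sum) auto
  also have "\<dots> = (\<Sum>j\<le>J. c j * measure M {x \<in> space M. h j x})"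
    using m by (intro sum.cong) auto
  finally show "(LINT x|M. (\<Sum>j\<le>J. c j * of_bool (h j x))) = (\<Sum>j\<le>J. c j * measure M {x \<in> space M. h j x})" .
qed

text \<open>All bad sets together cost at most the sum of the increments times \<eta>, that is
  \<open>level \<delta> J * \<eta> \<le> K * \<eta>\<close>; so \<eta> has to be small compared with
  \<delta> / K. The bracket around K says that F almost surely stays below level
  \<open>Suc J\<close>.\<close>

lemma (in prob_space) layer_compare:
  assumes \<delta>: "0 < \<delta>" "\<delta> < 1" and intF: "integrable M F"
    and F: "\<And>x. 0 \<le> F x" "AE x in M. F x \<le> K" and K: "level \<delta> J \<le> K" "K < level \<delta> (Suc J)"
    and mh: "\<And>j. j \<le> J \<Longrightarrow> Measurable.pred M (h j)"
    and mb: "\<And>j. j \<le> J \<Longrightarrow> Measurable.pred M (b j)"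
    and h: "\<And>j x. \<not> b j x \<Longrightarrow> level \<delta> j * (1 + \<delta>)\<^sup>2 \<le> F x \<Longrightarrow> h j x"
           "\<And>j x. \<not> b j x \<Longrightarrow> h j x \<Longrightarrow> level \<delta> j * (1 - \<delta>)\<^sup>2 \<le> F x"
    and bad: "\<And>j. j \<le> J \<Longrightarrow> measure M {x \<in> space M. b j x} \<le> \<eta>" "0 \<le> \<eta>"
  defines "G \<equiv> \<Sum>j\<le>J. level_inc \<delta> j * measure M {x \<in> space M. h j x}"
  shows "(1 - \<delta>)\<^sup>2 * (G - K * \<eta>) \<le> (LINT x|M. F x)"
    and "(LINT x|M. F x) \<le> (1 + \<delta>)\<^sup>2 * ((1 + \<delta>) * (G + K * \<eta>) + \<delta>)"
proof -
  define B where "B = (\<Sum>j\<le>J. level_inc \<delta> j * measure M {x \<in> space M. b j x})"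
  have "B \<le> (\<Sum>j\<le>J. level_inc \<delta> j * \<eta>)"
    unfolding B_def using bad level_inc_nonneg[OF \<delta>(1)] by (intro sum_mono mult_left_mono) auto
  also have "\<dots> = level \<delta> J * \<eta>" by (simp add: sum_level_inc flip: sum_distrib_right)
  also have "\<dots> \<le> K * \<eta>" using K bad(2) by (intro mult_right_mono)
  finally have B: "B \<le> K * \<eta>" .
  note hi = integral_layer_sum[of J h "level_inc \<delta>", OF mh]
  note bi = integral_layer_sum[of J b "level_inc \<delta>", OF mb]
  have p: "0 < (1 - \<delta>)\<^sup>2" "0 < (1 + \<delta>)\<^sup>2" using \<delta> by auto
  have "G = (LINT x|M. (\<Sum>j\<le>J. level_inc \<delta> j * of_bool (h j x)))"
    unfolding G_def by (rule hi(2)[symmetric])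
  also have "\<dots> \<le> (LINT x|M. F x / (1 - \<delta>)\<^sup>2 + (\<Sum>j\<le>J. level_inc \<delta> j * of_bool (b j x)))"
  proof (rule integral_mono_AE)
    show "AE x in M. (\<Sum>j\<le>J. level_inc \<delta> j * of_bool (h j x)) \<le> F x / (1 - \<delta>)\<^sup>2 + (\<Sum>j\<le>J. level_inc \<delta> j * of_bool (b j x))"
      using F(2) by eventually_elim (rule layer_compare_pointwise[OF \<delta> F(1)], use K h in auto)
  qed (use hi(1) bi(1) intF in auto)
  also have "\<dots> = (LINT x|M. F x) / (1 - \<delta>)\<^sup>2 + B"
    using bi intF by (simp add: B_def)
  finally have "G - K * \<eta> \<le> (LINT x|M. F x) / (1 - \<delta>)\<^sup>2" using B by simp
  then show "(1 - \<delta>)\<^sup>2 * (G - K * \<eta>) \<le> (LINT x|M. F x)"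
    using p by (simp add: pos_le_divide_eq mult.commute)
  have "(LINT x|M. F x) / (1 + \<delta>)\<^sup>2 = (LINT x|M. F x / (1 + \<delta>)\<^sup>2)" by simp
  also have "\<dots> \<le> (LINT x|M. (1 + \<delta>) * (\<Sum>j\<le>J. level_inc \<delta> j * of_bool (h j x))
            + (1 + \<delta>) * (\<Sum>j\<le>J. level_inc \<delta> j * of_bool (b j x)) + \<delta>)"
  proof (rule integral_mono_AE)
    show "AE x in M. F x / (1 + \<delta>)\<^sup>2 \<le> (1 + \<delta>) * (\<Sum>j\<le>J. level_inc \<delta> j * of_bool (h j x))
            + (1 + \<delta>) * (\<Sum>j\<le>J. level_inc \<delta> j * of_bool (b j x)) + \<delta>"
      using F(2) by eventually_elim (rule layer_compare_pointwise[OF \<delta> F(1)], use K h in auto)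
    show "integrable M (\<lambda>x. (1 + \<delta>) * (\<Sum>j\<le>J. level_inc \<delta> j * of_bool (h j x))
            + (1 + \<delta>) * (\<Sum>j\<le>J. level_inc \<delta> j * of_bool (b j x)) + \<delta>)"
      by (intro Bochner_Integration.integrable_add integrable_mult_right hi(1) bi(1)) auto
  qed (use intF in auto)
  also have "\<dots> = (1 + \<delta>) * G + (1 + \<delta>) * B + \<delta>"
    using hi bi by (simp add: B_def G_def prob_space)
  also have "\<dots> \<le> (1 + \<delta>) * (G + K * \<eta>) + \<delta>"
    using B \<delta> by (simp add: distrib_left)
  finally show "(LINT x|M. F x) \<le> (1 + \<delta>)\<^sup>2 * ((1 + \<delta>) * (G + K * \<eta>) + \<delta>)"
    using p by (simp add: pos_divide_le_eq mult.commute)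
qed

section \<open>Chernoff bound with relative error\<close>

lemma (in prob_space) indep_indicator_mgf_le:
  fixes s :: real
  assumes indep: "indep_vars (\<lambda>_. \<rho>) y I" and "finite I"
    and distr: "\<And>i. i \<in> I \<Longrightarrow> distr M \<rho> (y i) = \<rho>"
    and A: "A \<in> sets \<rho>"
  shows "integrable M (\<lambda>\<omega>. exp (s * (\<Sum>i\<in>I. indicator A (y i \<omega>))))"
    and "expectation (\<lambda>\<omega>. exp (s * (\<Sum>i\<in>I. indicator A (y i \<omega>))))
        \<le> exp (card I * measure \<rho> A * (exp s - 1))"
proof -
  let ?X = "\<lambda>i \<omega>. exp (s * indicator A (y i \<omega>)) :: real"
  have rv: "y i \<in> measurable M \<rho>" if "i \<in> I" for i using indep that by (auto simp: indep_vars_def)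
  have eq: "exp (s * (\<Sum>i\<in>I. indicator A (y i \<omega>))) = (\<Prod>i\<in>I. ?X i \<omega>)" for \<omega>
    by (simp only: sum_distrib_left exp_sum[OF \<open>finite I\<close>])
  \<comment> \<open>An indicator takes only the values 0 and 1, so its exponential is an affine
    function of it.\<close>
  have Xeq: "?X i \<omega> = 1 + (exp s - 1) * indicator (y i -` A \<inter> space M) \<omega>" if "\<omega> \<in> space M" for i \<omega>
    using that by (auto simp: indicator_def)
  have m: "y i -` A \<inter> space M \<in> sets M" if "i \<in> I" for i
    using rv[OF that] A by (rule measurable_sets)
  have fin: "emeasure M B < \<infinity>" for B by (simp add: less_top[symmetric])
  have int1: "integrable M (\<lambda>\<omega>. 1 + (exp s - 1) * indicator (y i -` A \<inter> space M) \<omega>)" if "i \<in> I" for i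
    by (intro Bochner_Integration.integrable_add integrable_mult_right integrable_real_indicator m[OF that] fin) auto
  have int: "integrable M (?X i)" if "i \<in> I" for i
    using int1[OF that] Xeq by (simp cong: Bochner_Integration.integrable_cong)
  have exX: "expectation (?X i) = 1 + (exp s - 1) * measure \<rho> A" if "i \<in> I" for i
  proof -
    have "expectation (?X i) = expectation (\<lambda>\<omega>. 1 + (exp s - 1) * indicator (y i -` A \<inter> space M) \<omega>)"
      using Xeq by (intro Bochner_Integration.integral_cong) auto
    also have "\<dots> = 1 + (exp s - 1) * prob (y i -` A \<inter> space M)"
    proof -
      have "integrable M (\<lambda>\<omega>. (exp s - 1) * indicator (y i -` A \<inter> space M) \<omega> :: real)"
        by (intro integrable_mult_right integrable_real_indicator m[OF that] fin)
      then show ?thesis using m[OF that] by (simp add: prob_space)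
    qed
    also have "prob (y i -` A \<inter> space M) = measure (distr M \<rho> (y i)) A"
      using rv[OF that] A by (simp add: measure_distr)
    finally show ?thesis using distr[OF that] by simp
  qed
  have indepX: "indep_vars (\<lambda>_. borel) ?X I"
    by (rule indep_vars_compose2[OF indep])
       (use A in \<open>auto intro!: borel_measurable_exp borel_measurable_times borel_measurable_indicator\<close>)
  show "integrable M (\<lambda>\<omega>. exp (s * (\<Sum>i\<in>I. indicator A (y i \<omega>))))"
    unfolding eq by (rule indep_vars_integrable[OF \<open>finite I\<close> indepX int])
  have "expectation (\<lambda>\<omega>. exp (s * (\<Sum>i\<in>I. indicator A (y i \<omega>)))) = (\<Prod>i\<in>I. expectation (?X i))"
    unfolding eq by (rule indep_vars_lebesgue_integral[OF \<open>finite I\<close> indepX int])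
  also have "\<dots> = (\<Prod>i\<in>I. 1 + (exp s - 1) * measure \<rho> A)"
    by (intro prod.cong refl exX)
  also have "\<dots> \<le> (\<Prod>i\<in>I. exp ((exp s - 1) * measure \<rho> A))"
  proof (intro prod_mono conjI)
    fix i assume "i \<in> I"
    \<comment> \<open>For negative s the sign is not evident from the formula; the factor is the
      expectation of a positive variable.\<close>
    show "0 \<le> 1 + (exp s - 1) * measure \<rho> A"
      unfolding exX[OF \<open>i \<in> I\<close>, symmetric] by (intro integral_nonneg_AE) auto
  qed (simp add: add.commute exp_ge_add_one_self)
  also have "\<dots> = exp (card I * measure \<rho> A * (exp s - 1))"
    by (simp add: exp_of_nat_mult[symmetric] ac_simps)
  finally show "expectation (\<lambda>\<omega>. exp (s * (\<Sum>i\<in>I. indicator A (y i \<omega>))))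
        \<le> exp (card I * measure \<rho> A * (exp s - 1))" .
qed

text \<open>The parameter s may have either sign and stays inside the event, so the same bound
  serves the upper and the lower tail.\<close>

lemma (in prob_space) indep_indicator_chernoff:
  fixes s c :: real
  assumes indep: "indep_vars (\<lambda>_. \<rho>) y I" and "finite I"
    and distr: "\<And>i. i \<in> I \<Longrightarrow> distr M \<rho> (y i) = \<rho>"
    and A: "A \<in> sets \<rho>"
  shows "prob {\<omega> \<in> space M. c \<le> s * (\<Sum>i\<in>I. indicator A (y i \<omega>))}
         \<le> exp (card I * measure \<rho> A * (exp s - 1) - c)"
proof -
  note mgf = indep_indicator_mgf_le[OF assms, of s]
  have "prob {\<omega> \<in> space M. c \<le> s * (\<Sum>i\<in>I. indicator A (y i \<omega>))}
     = prob {\<omega> \<in> space M. exp c \<le> exp (s * (\<Sum>i\<in>I. indicator A (y i \<omega>)))}" by simp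
  also have "\<dots> \<le> expectation (\<lambda>\<omega>. exp (s * (\<Sum>i\<in>I. indicator A (y i \<omega>)))) / exp c"
    by (rule integral_Markov_inequality_measure[OF mgf(1), where A = "{}"]) auto
  also have "\<dots> \<le> exp (card I * measure \<rho> A * (exp s - 1)) / exp c"
    by (intro divide_right_mono mgf(2)) auto
  finally show ?thesis by (simp add: exp_diff)
qed

text \<open>With exponent \<open>\<plusminus>\<delta>\<close> the second-order term of \<open>exp\<close> is absorbed by the relative error
  \<open>\<delta> * p\<close>.\<close>

lemma (in prob_space) relative_chernoff:
  fixes \<delta> u p :: real
  assumes indep: "indep_vars (\<lambda>_. \<rho>) y I" and "finite I"
    and distr: "\<And>i. i \<in> I \<Longrightarrow> distr M \<rho> (y i) = \<rho>"
    and A: "A \<in> sets \<rho>" and \<delta>: "0 < \<delta>" "\<delta> \<le> 1"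
  defines "p \<equiv> measure \<rho> A"
  shows "prob {\<omega> \<in> space M. card I * (\<delta> * p + u) \<le> \<bar>(\<Sum>i\<in>I. indicator A (y i \<omega>)) - card I * p\<bar>}
         \<le> 2 * exp (- (\<delta> * u * card I))"
proof -
  note ch = indep_indicator_chernoff[OF assms(1-4)]
  let ?S = "\<lambda>\<omega>. \<Sum>i\<in>I. indicator A (y i \<omega>) :: real"
  let ?m = "real (card I)"
  have p: "0 \<le> p" by (simp add: p_def)
  have rv: "y i \<in> measurable M \<rho>" if "i \<in> I" for i using indep that by (auto simp: indep_vars_def)
  have mS: "?S \<in> borel_measurable M"
    by (rule borel_measurable_sum) (rule measurable_compose[OF rv borel_measurable_indicator[OF A]])
  define U where "U = {\<omega> \<in> space M. \<delta> * (?m * (p + \<delta> * p + u)) \<le> \<delta> * ?S \<omega>}"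
  define D where "D = {\<omega> \<in> space M. - \<delta> * (?m * (p - \<delta> * p - u)) \<le> - \<delta> * ?S \<omega>}"
  have UD: "U \<in> events" "D \<in> events"
    unfolding U_def D_def using mS
    by (intro borel_measurable_le borel_measurable_times borel_measurable_const; simp)+
  have e1: "exp \<delta> - 1 \<le> \<delta> + \<delta>\<^sup>2" using exp_bound[of \<delta>] \<delta> by simp
  have e2: "exp (- \<delta>) - 1 \<le> - \<delta> + \<delta>\<^sup>2"
  proof -
    have "exp (-\<delta>) = 1 / exp \<delta>" by (simp add: exp_minus field_simps)
    also have "\<dots> \<le> 1 / (1 + \<delta>)" using \<delta> by (intro divide_left_mono) (auto simp: exp_ge_add_one_self)
    also have "\<dots> \<le> 1 - \<delta> + \<delta>\<^sup>2"
    proof -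
      have "(1 - \<delta> + \<delta>\<^sup>2) * (1 + \<delta>) = 1 + \<delta> ^ 3"
        by (simp add: power2_eq_square power3_eq_cube algebra_simps)
      then show ?thesis using \<delta> by (simp add: pos_divide_le_eq)
    qed
    finally show ?thesis by simp
  qed
  have "prob U \<le> exp (?m * p * (exp \<delta> - 1) - \<delta> * (?m * (p + \<delta> * p + u)))"
    unfolding U_def p_def by (rule ch)
  also have "\<dots> \<le> exp (?m * p * (\<delta> + \<delta>\<^sup>2) - \<delta> * (?m * (p + \<delta> * p + u)))"
    unfolding exp_le_cancel_iff using e1 p by (intro diff_right_mono mult_left_mono) auto
  also have "\<dots> = exp (- (\<delta> * u * ?m))" by (simp add: power2_eq_square algebra_simps)
  finally have PU: "prob U \<le> exp (- (\<delta> * u * ?m))" .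
  have "prob D \<le> exp (?m * p * (exp (- \<delta>) - 1) - (- \<delta> * (?m * (p - \<delta> * p - u))))"
    unfolding D_def p_def by (rule ch)
  also have "\<dots> \<le> exp (?m * p * (- \<delta> + \<delta>\<^sup>2) - (- \<delta> * (?m * (p - \<delta> * p - u))))"
    unfolding exp_le_cancel_iff using e2 p by (intro diff_right_mono mult_left_mono) auto
  also have "\<dots> = exp (- (\<delta> * u * ?m))" by (simp add: power2_eq_square algebra_simps)
  finally have PD: "prob D \<le> exp (- (\<delta> * u * ?m))" .
  have "{\<omega> \<in> space M. ?m * (\<delta> * p + u) \<le> \<bar>?S \<omega> - ?m * p\<bar>} \<subseteq> U \<union> D"
  proof safe
    fix \<omega> assume \<omega>: "\<omega> \<in> space M" "?m * (\<delta> * p + u) \<le> \<bar>?S \<omega> - ?m * p\<bar>" "\<omega> \<notin> D"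
    have "\<not> ?S \<omega> \<le> ?m * (p - \<delta> * p - u)"
      using \<omega>(1,3) \<delta> by (simp add: D_def)
    then have "?m * (p + \<delta> * p + u) \<le> ?S \<omega>" using \<omega>(2) by (simp add: algebra_simps abs_if split: if_splits)
    then show "\<omega> \<in> U" using \<omega>(1) \<delta> by (simp add: U_def)
  qed
  then have "prob {\<omega> \<in> space M. ?m * (\<delta> * p + u) \<le> \<bar>?S \<omega> - ?m * p\<bar>} \<le> prob (U \<union> D)"
    using UD by (intro finite_measure_mono) auto
  also have "\<dots> \<le> prob U + prob D" using UD by (intro measure_Un_le)
  finally show ?thesis using PU PD by simp
qed

section \<open>Measurability of positive definiteness\<close>

definition sq_norm :: "'i set \<Rightarrow> ('i \<Rightarrow> complex) \<Rightarrow> real" where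
  "sq_norm S z = (\<Sum>\<nu>\<in>S. (cmod (z \<nu>))\<^sup>2)"

text \<open>Unlike in \<open>vec_supp\<close>, every coordinate outside the set is forced to vanish;
  free coordinates would destroy the compactness of the unit sphere in the product topology.\<close>

definition supported_on :: "'i set \<Rightarrow> ('i \<Rightarrow> complex) \<Rightarrow> bool" where
  "supported_on S z \<longleftrightarrow> (\<forall>\<nu>. \<nu> \<notin> S \<longrightarrow> z \<nu> = 0)"

lemma sq_norm_scale: "sq_norm S (\<lambda>\<nu>. of_real c * z \<nu>) = c\<^sup>2 * sq_norm S z"
  by (simp add: sq_norm_def norm_mult power_mult_distrib sum_distrib_left)

lemma continuous_on_sq_norm: "continuous_on UNIV (sq_norm S :: ('i \<Rightarrow> complex) \<Rightarrow> real)"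
  unfolding sq_norm_def[abs_def] by (intro continuous_intros continuous_on_product_coordinates)

lemma sq_norm_pos_iff: "finite S \<Longrightarrow> supported_on S z \<Longrightarrow> 0 < sq_norm S z \<longleftrightarrow> z \<noteq> (\<lambda>_. 0)"
  unfolding sq_norm_def supported_on_def
  by (subst less_le) (auto simp: sum_nonneg sum_nonneg_eq_0_iff fun_eq_iff eq_commute[of 0])

text \<open>A product of closed balls over S and single points elsewhere is compact by Tychonoff's
  theorem, and the norm condition is closed.\<close>

lemma compact_sq_norm_sphere:
  assumes "finite S"
  shows "compact {z. supported_on S z \<and> sq_norm S z = 1}"
proof -
  let ?B = "\<lambda>\<nu>. if \<nu> \<in> S then cball (0::complex) 1 else {0}"
  have "compactin (product_topology (\<lambda>_. euclidean) UNIV) (PiE UNIV ?B)"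
    by (subst compactin_PiE) auto
  then have "compact (PiE UNIV ?B)"
    by (simp add: euclidean_product_topology)
  moreover have "closed {z. sq_norm S z = 1}"
    using continuous_on_sq_norm by (intro closed_Collect_eq) auto
  ultimately have "compact (PiE UNIV ?B \<inter> {z. sq_norm S z = 1})" by (rule compact_Int_closed)
  also have "PiE UNIV ?B \<inter> {z. sq_norm S z = 1} = {z. supported_on S z \<and> sq_norm S z = 1}"
  proof (intro equalityI subsetI)
    fix z assume z: "z \<in> {z. supported_on S z \<and> sq_norm S z = 1}"
    have "cmod (z \<nu>) \<le> 1" if "\<nu> \<in> S" for \<nu>
    proof -
      have "(cmod (z \<nu>))\<^sup>2 \<le> sq_norm S z"
        unfolding sq_norm_def using assms that by (intro member_le_sum) auto
      then show ?thesis using z by (simp add: power_le_one_iff)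
    qed
    then show "z \<in> PiE UNIV ?B \<inter> {z. sq_norm S z = 1}"
      using z by (auto simp: supported_on_def PiE_iff)
  next
    fix z assume "z \<in> PiE UNIV ?B \<inter> {z. sq_norm S z = 1}"
    then show "z \<in> {z. supported_on S z \<and> sq_norm S z = 1}"
      by (auto simp: supported_on_def PiE_iff split: if_splits)
  qed
  finally show ?thesis .
qed

text \<open>Functions from a finite set into a countable dense set of complex numbers, continued by
  0, are countably many. Basic open sets of the product topology are boxes, so it suffices to
  approximate each coordinate.\<close>

lemma countable_dense_supported:
  assumes "finite S"
  obtains D :: "('i \<Rightarrow> complex) set" where "countable D" "\<And>z. z \<in> D \<Longrightarrow> supported_on S z"
    and "\<And>W z. open W \<Longrightarrow> z \<in> W \<Longrightarrow> supported_on S z \<Longrightarrow> \<exists>d\<in>D. d \<in> W"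
proof -
  obtain D0 :: "complex set" where D0: "countable D0" "\<And>X. open X \<Longrightarrow> X \<noteq> {} \<Longrightarrow> \<exists>d\<in>D0. d \<in> X"
    by (rule countable_dense_setE) blast
  define D where "D = (\<lambda>z \<nu>. if \<nu> \<in> S then z \<nu> else 0) ` (PiE S (\<lambda>_. D0))"
  show ?thesis
  proof
    show "countable D" unfolding D_def using assms D0(1) by (intro countable_image countable_PiE) auto
    show "supported_on S z" if "z \<in> D" for z using that by (auto simp: D_def supported_on_def)
  next
    fix W :: "('i \<Rightarrow> complex) set" and z assume W: "open W" "z \<in> W" and z: "supported_on S z"
    obtain X where X: "z \<in> PiE UNIV X" "\<And>\<nu>. open (X \<nu>)" "PiE UNIV X \<subseteq> W"
      using product_topology_open_contains_basis[of "\<lambda>_. euclidean" UNIV W z] W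
      by (auto simp: open_fun_def)
    have "\<exists>d\<in>D0. d \<in> X \<nu>" for \<nu> using X by (intro D0(2)) auto
    then obtain d where d: "\<And>\<nu>. d \<nu> \<in> D0" "\<And>\<nu>. d \<nu> \<in> X \<nu>" by metis
    have "(\<lambda>\<nu>. if \<nu> \<in> S then (restrict d S) \<nu> else 0) \<in> D"
      unfolding D_def using d by (intro imageI) auto
    moreover have "(\<lambda>\<nu>. if \<nu> \<in> S then (restrict d S) \<nu> else 0) \<in> W"
    proof (rule subsetD[OF X(3)])
      show "(\<lambda>\<nu>. if \<nu> \<in> S then (restrict d S) \<nu> else 0) \<in> PiE UNIV X"
        using d X(1) z by (auto simp: PiE_iff supported_on_def) (metis)
    qed
    ultimately show "\<exists>d\<in>D. d \<in> W" by blast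
  qed
qed

text \<open>By compactness of the unit sphere a positive definite form is bounded below by a
  multiple of the norm, and the latter can be tested on a countable dense set.\<close>

lemma sets_positive_definite:
  fixes g :: "'w \<Rightarrow> ('i \<Rightarrow> complex) \<Rightarrow> real"
  assumes S: "finite S"
    and meas: "\<And>z. (\<lambda>\<omega>. g \<omega> z) \<in> borel_measurable M"
    and cont: "\<And>\<omega>. continuous_on UNIV (g \<omega>)"
    and scale: "\<And>\<omega> c z. g \<omega> (\<lambda>\<nu>. of_real c * z \<nu>) = c\<^sup>2 * g \<omega> z"
  shows "{\<omega> \<in> space M. \<forall>z. supported_on S z \<and> z \<noteq> (\<lambda>_. 0) \<longrightarrow> 0 < g \<omega> z} \<in> sets M"
proof -
  obtain D :: "('i \<Rightarrow> complex) set" where D: "countable D" "\<And>z. z \<in> D \<Longrightarrow> supported_on S z"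
    "\<And>W z. open W \<Longrightarrow> z \<in> W \<Longrightarrow> supported_on S z \<Longrightarrow> \<exists>d\<in>D. d \<in> W"
    using countable_dense_supported[OF S] by blast
  have iff: "(\<forall>z. supported_on S z \<and> z \<noteq> (\<lambda>_. 0) \<longrightarrow> 0 < g \<omega> z) \<longleftrightarrow>
      (\<exists>n::nat. \<forall>z\<in>D. sq_norm S z / real (Suc n) \<le> g \<omega> z)" for \<omega>
  proof
    assume pos: "\<forall>z. supported_on S z \<and> z \<noteq> (\<lambda>_. 0) \<longrightarrow> 0 < g \<omega> z"
    let ?K = "{z. supported_on S z \<and> sq_norm S z = 1}"
    have "\<exists>\<mu>>0. \<forall>z\<in>?K. \<mu> \<le> g \<omega> z"
    proof (cases "?K = {}")
      case True
      then show ?thesis by (intro exI[of _ 1]) auto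
    next
      case False
      have "\<exists>x\<in>?K. \<forall>y\<in>?K. g \<omega> x \<le> g \<omega> y"
        using compact_sq_norm_sphere[OF S] False continuous_on_subset[OF cont]
        by (intro continuous_attains_inf) auto
      then obtain x where x: "x \<in> ?K" "\<forall>y\<in>?K. g \<omega> x \<le> g \<omega> y" by blast
      have "0 < g \<omega> x" using pos x(1) sq_norm_pos_iff[OF S, of x] by auto
      then show ?thesis using x(2) by blast
    qed
    then obtain \<mu> where \<mu>: "0 < \<mu>" "\<And>z. z \<in> ?K \<Longrightarrow> \<mu> \<le> g \<omega> z" by blast
    obtain n where n: "1 / real (Suc n) < \<mu>" using nat_approx_posE[OF \<mu>(1)] by blast
    show "\<exists>n::nat. \<forall>z\<in>D. sq_norm S z / real (Suc n) \<le> g \<omega> z"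
    proof (intro exI ballI)
      fix z assume "z \<in> D"
      then have z: "supported_on S z" by (rule D(2))
      show "sq_norm S z / real (Suc n) \<le> g \<omega> z"
      proof (cases "z = (\<lambda>_. 0)")
        case True
        then show ?thesis using scale[of \<omega> 0 "\<lambda>_. 0"] by (simp add: sq_norm_def)
      next
        case False
        define r where "r = sqrt (sq_norm S z)"
        have r: "0 < r" "r\<^sup>2 = sq_norm S z" using False sq_norm_pos_iff[OF S z] by (auto simp: r_def)
        have eq: "z = (\<lambda>\<nu>. of_real r * (of_real (1 / r) * z \<nu>))"
          using r by (simp add: fun_eq_iff)
        have "(\<lambda>\<nu>. of_real (1 / r) * z \<nu>) \<in> ?K"
          using z r(1) unfolding mem_Collect_eq sq_norm_scale
          by (simp add: supported_on_def power_one_over flip: r(2))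
        then have "1 / real (Suc n) \<le> g \<omega> (\<lambda>\<nu>. of_real (1 / r) * z \<nu>)"
          using \<mu>(2) n by fastforce
        then have "r\<^sup>2 * (1 / real (Suc n)) \<le> r\<^sup>2 * g \<omega> (\<lambda>\<nu>. of_real (1 / r) * z \<nu>)"
          by (intro mult_left_mono) auto
        also have "\<dots> = g \<omega> (\<lambda>\<nu>. of_real r * (of_real (1 / r) * z \<nu>))" by (rule scale[symmetric])
        also have "\<dots> = g \<omega> z" by (subst (2) eq) (rule refl)
        finally show ?thesis using r(2) by simp
      qed
    qed
  next
    assume "\<exists>n::nat. \<forall>z\<in>D. sq_norm S z / real (Suc n) \<le> g \<omega> z"
    then obtain n where n: "\<And>z. z \<in> D \<Longrightarrow> sq_norm S z / real (Suc n) \<le> g \<omega> z" by blast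
    show "\<forall>z. supported_on S z \<and> z \<noteq> (\<lambda>_. 0) \<longrightarrow> 0 < g \<omega> z"
    proof safe
      fix z :: "'i \<Rightarrow> complex" assume z: "supported_on S z" "z \<noteq> (\<lambda>_. 0)"
      have "sq_norm S z / real (Suc n) \<le> g \<omega> z"
      proof (rule ccontr)
        assume *: "\<not> sq_norm S z / real (Suc n) \<le> g \<omega> z"
        \<comment> \<open>The set where the inequality fails is open, so it would contain a point of
          D. Only a non-strict inequality passes to the closure; the positive multiple of the norm
          then restores strictness.\<close>
        have "open {z. g \<omega> z < sq_norm S z / real (Suc n)}"
          using cont continuous_on_sq_norm by (intro open_Collect_less continuous_intros) auto
        from D(3)[OF this _ z(1)] * n show False by fastforce
      qed
      moreover have "0 < sq_norm S z / real (Suc n)" using z sq_norm_pos_iff[OF S] by auto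
      ultimately show "0 < g \<omega> z" by linarith
    qed
  qed
  have "{\<omega> \<in> space M. \<exists>n::nat. \<forall>z\<in>D. sq_norm S z / real (Suc n) \<le> g \<omega> z} \<in> sets M"
    using D(1) meas
    by (intro sets.sets_Collect_countable_Ex sets.sets_Collect_countable_Ball borel_measurable_le) auto
  then show ?thesis by (simp only: iff)
qed

section \<open>Restricted isometry from concentrated votes\<close>

text \<open>Cauchy-Schwarz over the support. For unit z it yields the bound by K that permits the
  levels to stop near K.\<close>

lemma cmod_lin_le:
  assumes "finite J"
  shows "(cmod (lin J \<Psi> z x))\<^sup>2 \<le> (\<Sum>\<nu>\<in>vec_supp J z. (cmod (\<Psi> \<nu> x))\<^sup>2) * (\<Sum>\<nu>\<in>J. (cmod (z \<nu>))\<^sup>2)"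
proof -
  have "lin J \<Psi> z x = (\<Sum>\<nu>\<in>vec_supp J z. \<Psi> \<nu> x * z \<nu>)"
    unfolding lin_def using assms by (intro sum.mono_neutral_right) (auto simp: vec_supp_def)
  then have "cmod (lin J \<Psi> z x) \<le> (\<Sum>\<nu>\<in>vec_supp J z. cmod (\<Psi> \<nu> x) * cmod (z \<nu>))"
    by (simp add: sum_norm_le norm_mult)
  then have "(cmod (lin J \<Psi> z x))\<^sup>2 \<le> (\<Sum>\<nu>\<in>vec_supp J z. cmod (\<Psi> \<nu> x) * cmod (z \<nu>))\<^sup>2"
    by (intro power_mono) auto
  also have "\<dots> \<le> (\<Sum>\<nu>\<in>vec_supp J z. (cmod (\<Psi> \<nu> x))\<^sup>2) * (\<Sum>\<nu>\<in>vec_supp J z. (cmod (z \<nu>))\<^sup>2)"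
    by (rule Cauchy_Schwarz_ineq_sum)
  also have "(\<Sum>\<nu>\<in>vec_supp J z. (cmod (z \<nu>))\<^sup>2) = (\<Sum>\<nu>\<in>J. (cmod (z \<nu>))\<^sup>2)"
    using assms by (intro sum.mono_neutral_left) (auto simp: vec_supp_def)
  finally show ?thesis .
qed

lemma orthonormal_integrable_mult:
  assumes "orthonormal_system \<rho> J \<Psi>" "\<nu> \<in> J" "\<mu> \<in> J"
  shows "integrable \<rho> (\<lambda>x. \<Psi> \<nu> x * cnj (\<Psi> \<mu> x))"
proof (rule Bochner_Integration.integrable_bound)
  have m: "\<Psi> \<nu> \<in> borel_measurable \<rho>" "\<Psi> \<mu> \<in> borel_measurable \<rho>"
    and i: "integrable \<rho> (\<lambda>x. (cmod (\<Psi> \<nu> x))\<^sup>2)" "integrable \<rho> (\<lambda>x. (cmod (\<Psi> \<mu> x))\<^sup>2)"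
    using assms by (auto simp: orthonormal_system_def)
  show "integrable \<rho> (\<lambda>x. (cmod (\<Psi> \<nu> x))\<^sup>2 + (cmod (\<Psi> \<mu> x))\<^sup>2)" using i by simp
  show "(\<lambda>x. \<Psi> \<nu> x * cnj (\<Psi> \<mu> x)) \<in> borel_measurable \<rho>"
    using m by (intro borel_measurable_times)
      (auto intro: borel_measurable_continuous_on[OF continuous_on_cnj[OF continuous_on_id]])
  show "AE x in \<rho>. norm (\<Psi> \<nu> x * cnj (\<Psi> \<mu> x)) \<le> norm ((cmod (\<Psi> \<nu> x))\<^sup>2 + (cmod (\<Psi> \<mu> x))\<^sup>2)"
  proof (rule AE_I2)
    fix x
    have "2 * (cmod (\<Psi> \<nu> x) * cmod (\<Psi> \<mu> x)) \<le> (cmod (\<Psi> \<nu> x))\<^sup>2 + (cmod (\<Psi> \<mu> x))\<^sup>2"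
      using sum_squares_bound[of "cmod (\<Psi> \<nu> x)" "cmod (\<Psi> \<mu> x)"] by (simp only: mult.assoc)
    moreover have "0 \<le> cmod (\<Psi> \<nu> x) * cmod (\<Psi> \<mu> x)" by simp
    ultimately have "cmod (\<Psi> \<nu> x) * cmod (\<Psi> \<mu> x) \<le> (cmod (\<Psi> \<nu> x))\<^sup>2 + (cmod (\<Psi> \<mu> x))\<^sup>2" by linarith
    then show "norm (\<Psi> \<nu> x * cnj (\<Psi> \<mu> x)) \<le> norm ((cmod (\<Psi> \<nu> x))\<^sup>2 + (cmod (\<Psi> \<mu> x))\<^sup>2)"
      by (simp add: norm_mult)
  qed
qed

lemma orthonormal_parseval:
  assumes on: "orthonormal_system \<rho> J \<Psi>" and J: "finite J"
  shows "integrable \<rho> (\<lambda>x. (cmod (lin J \<Psi> z x))\<^sup>2)"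
    and "(LINT x|\<rho>. (cmod (lin J \<Psi> z x))\<^sup>2) = (\<Sum>\<nu>\<in>J. (cmod (z \<nu>))\<^sup>2)"
proof -
  have eq: "complex_of_real ((cmod (lin J \<Psi> z x))\<^sup>2) =
      (\<Sum>\<nu>\<in>J. \<Sum>\<mu>\<in>J. (z \<nu> * cnj (z \<mu>)) * (\<Psi> \<nu> x * cnj (\<Psi> \<mu> x)))" for x
    unfolding complex_norm_square lin_def
    by (simp add: sum_product ac_simps)
  have int: "integrable \<rho> (\<lambda>x. (z \<nu> * cnj (z \<mu>)) * (\<Psi> \<nu> x * cnj (\<Psi> \<mu> x)))" if "\<nu> \<in> J" "\<mu> \<in> J" for \<nu> \<mu>
    using orthonormal_integrable_mult[OF on that] by (rule integrable_mult_right)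
  have intc: "integrable \<rho> (\<lambda>x. complex_of_real ((cmod (lin J \<Psi> z x))\<^sup>2))"
    unfolding eq by (intro Bochner_Integration.integrable_sum int)
  then show "integrable \<rho> (\<lambda>x. (cmod (lin J \<Psi> z x))\<^sup>2)" using integrable_Re[OF intc] by simp
  have "complex_of_real (LINT x|\<rho>. (cmod (lin J \<Psi> z x))\<^sup>2) = (LINT x|\<rho>. complex_of_real ((cmod (lin J \<Psi> z x))\<^sup>2))"
    by (rule integral_complex_of_real[symmetric])
  also have "\<dots> = (\<Sum>\<nu>\<in>J. \<Sum>\<mu>\<in>J. LINT x|\<rho>. (z \<nu> * cnj (z \<mu>)) * (\<Psi> \<nu> x * cnj (\<Psi> \<mu> x)))"
    unfolding eq using int
    by (subst Bochner_Integration.integral_sum)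
       (auto intro!: Bochner_Integration.integrable_sum sum.cong Bochner_Integration.integral_sum)
  also have "\<dots> = (\<Sum>\<nu>\<in>J. \<Sum>\<mu>\<in>J. (z \<nu> * cnj (z \<mu>)) * (if \<nu> = \<mu> then 1 else 0))"
    using on by (intro sum.cong refl) (simp add: orthonormal_system_def)
  also have "\<dots> = (\<Sum>\<nu>\<in>J. z \<nu> * cnj (z \<nu>))"
    using J by (intro sum.cong refl) (simp add: if_distrib cong: if_cong)
  also have "\<dots> = complex_of_real (\<Sum>\<nu>\<in>J. (cmod (z \<nu>))\<^sup>2)"
    by (simp add: complex_norm_square del: of_real_power)
  finally show "(LINT x|\<rho>. (cmod (lin J \<Psi> z x))\<^sup>2) = (\<Sum>\<nu>\<in>J. (cmod (z \<nu>))\<^sup>2)"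
    by (simp only: of_real_eq_iff)
qed

text \<open>Here G and G' are the layer sums of one family of votes under \<rho> and under the
  empirical measure, and F is the empirical mean. The known integral 1 puts G between
  \<open>1 - 4.01 * \<delta>\<close> and \<open>1 + 2.31 * \<delta>\<close>; c carries this over to
  G', and b to F. Throughout, \<open>\<delta> * \<delta> \<le> \<delta> / 13\<close> linearizes the
  quadratic terms.\<close>

lemma two_sided_layer_bounds_arith:
  fixes \<delta> \<epsilon> G G' F :: real
  assumes \<delta>: "0 < \<delta>" "\<delta> < 1 / 13" and \<epsilon>: "0 \<le> \<epsilon>" "\<epsilon> \<le> \<delta> / 100"
    and a: "(1 - \<delta>)\<^sup>2 * (G - \<epsilon>) \<le> 1" "1 \<le> (1 + \<delta>)\<^sup>2 * ((1 + \<delta>) * (G + \<epsilon>) + \<delta>)"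
    and b: "(1 - \<delta>)\<^sup>2 * (G' - \<epsilon>) \<le> F" "F \<le> (1 + \<delta>)\<^sup>2 * ((1 + \<delta>) * (G' + \<epsilon>) + \<delta>)"
    and c: "\<bar>G' - G\<bar> \<le> \<delta> * G + \<delta>"
  shows "1 - 13 * \<delta> < F" "F < 1 + 13 * \<delta>"
proof -
  have d2: "0 \<le> \<delta> * \<delta>" "\<delta> * \<delta> \<le> \<delta> / 13" using \<delta> by (auto simp: mult_le_cancel_left)
  have d3: "0 \<le> \<delta> * \<delta> * \<delta>" using \<delta> by simp
  \<comment> \<open>With \<open>23 / 10\<close> in place of 2 the expansion below keeps
    \<open>3 / 10 * \<delta>\<close>, which just exceeds the negative term, at most
    \<open>36 / 130 * \<delta>\<close>.\<close>
  have "G - \<epsilon> \<le> 1 + (23 / 10) * \<delta>"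
  proof (rule ccontr)
    assume "\<not> G - \<epsilon> \<le> 1 + (23 / 10) * \<delta>"
    then have "(1 - \<delta>)\<^sup>2 * (1 + (23 / 10) * \<delta>) < (1 - \<delta>)\<^sup>2 * (G - \<epsilon>)"
      using \<delta> by (intro mult_strict_left_mono) auto
    moreover have "(1 - \<delta>)\<^sup>2 * (1 + (23 / 10) * \<delta>) = 1 + (3 / 10) * \<delta> - (36 / 10) * (\<delta> * \<delta>) + (23 / 10) * (\<delta> * \<delta> * \<delta>)"
      by (simp add: power2_eq_square field_simps)
    ultimately show False using a(1) d2 d3 by linarith
  qed
  then have G: "G \<le> 1 + (231 / 100) * \<delta>" using \<epsilon> by linarith
  have "G' \<le> (1 + \<delta>) * G + \<delta>" using c by (simp add: algebra_simps abs_if split: if_splits)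
  also have "(1 + \<delta>) * G \<le> (1 + \<delta>) * (1 + (231 / 100) * \<delta>)" using G \<delta> by (intro mult_left_mono) auto
  also have "\<dots> = 1 + (331 / 100) * \<delta> + (231 / 100) * (\<delta> * \<delta>)" by (simp add: field_simps)
  finally have G': "G' + \<epsilon> \<le> 1 + (45 / 10) * \<delta>" using \<epsilon> d2 by linarith
  have "F \<le> (1 + \<delta>)\<^sup>2 * ((1 + \<delta>) * (G' + \<epsilon>) + \<delta>)" by (rule b)
  also have "\<dots> \<le> (1 + \<delta>)\<^sup>2 * ((1 + \<delta>) * (1 + (45 / 10) * \<delta>) + \<delta>)"
    using G' \<delta> by (intro mult_left_mono add_right_mono) auto
  also have "\<dots> \<le> (1 + (208 / 100) * \<delta>) * (1 + (685 / 100) * \<delta>)"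
  proof (rule mult_mono)
    have "(1 + \<delta>)\<^sup>2 = 1 + 2 * \<delta> + \<delta> * \<delta>" by (simp add: power2_eq_square algebra_simps)
    then show "(1 + \<delta>)\<^sup>2 \<le> 1 + (208 / 100) * \<delta>" using d2 by linarith
    have "(1 + \<delta>) * (1 + (45 / 10) * \<delta>) + \<delta> = 1 + (65 / 10) * \<delta> + (45 / 10) * (\<delta> * \<delta>)" by (simp add: field_simps)
    then show "(1 + \<delta>) * (1 + (45 / 10) * \<delta>) + \<delta> \<le> 1 + (685 / 100) * \<delta>" using d2 by linarith
  qed (use \<delta> in auto)
  also have "\<dots> = 1 + (893 / 100) * \<delta> + (14248 / 1000) * (\<delta> * \<delta>)" by (simp add: field_simps)
  also have "\<dots> < 1 + 13 * \<delta>" using d2 \<delta> by linarith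
  finally show "F < 1 + 13 * \<delta>" .
  have "1 - 4 * \<delta> \<le> G + \<epsilon>"
  proof (rule ccontr)
    assume "\<not> 1 - 4 * \<delta> \<le> G + \<epsilon>"
    then have "(1 + \<delta>)\<^sup>2 * ((1 + \<delta>) * (G + \<epsilon>) + \<delta>) < (1 + \<delta>)\<^sup>2 * ((1 + \<delta>) * (1 - 4 * \<delta>) + \<delta>)"
      using \<delta> by (intro mult_strict_left_mono add_strict_right_mono) auto
    also have "\<dots> = (1 + 2 * \<delta> + \<delta> * \<delta>) * (1 - 2 * \<delta> - 4 * (\<delta> * \<delta>))"
      by (simp add: power2_eq_square algebra_simps)
    \<comment> \<open>Weakening \<open>- 4 * (\<delta> * \<delta>)\<close> makes the product a
      difference of squares, \<open>1 - (2 * \<delta> + \<delta> * \<delta>)^2\<close>.\<close>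
    also have "\<dots> \<le> (1 + 2 * \<delta> + \<delta> * \<delta>) * (1 - 2 * \<delta> - \<delta> * \<delta>)"
      using d2 \<delta> by (intro mult_left_mono) auto
    also have "\<dots> = 1 - (2 * \<delta> + \<delta> * \<delta>) * (2 * \<delta> + \<delta> * \<delta>)" by (simp add: algebra_simps)
    also have "\<dots> \<le> 1" by simp
    finally show False using a(2) by simp
  qed
  then have Gl: "1 - (401 / 100) * \<delta> \<le> G" using \<epsilon> by simp
  have "(1 - \<delta>) * (1 - (401 / 100) * \<delta>) = 1 - (501 / 100) * \<delta> + (401 / 100) * (\<delta> * \<delta>)" by (simp add: field_simps)
  then have "1 - (501 / 100) * \<delta> \<le> (1 - \<delta>) * (1 - (401 / 100) * \<delta>)" using d2 by linarith
  also have "\<dots> \<le> (1 - \<delta>) * G" using Gl \<delta> by (intro mult_left_mono) auto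
  also have "\<dots> \<le> G' + \<delta>" using c by (simp add: algebra_simps abs_if split: if_splits)
  finally have "1 - (602 / 100) * \<delta> \<le> G' - \<epsilon>" using \<epsilon> by simp
  then have "(1 - \<delta>)\<^sup>2 * (1 - (602 / 100) * \<delta>) \<le> (1 - \<delta>)\<^sup>2 * (G' - \<epsilon>)" by (intro mult_left_mono) auto
  moreover have "(1 - 2 * \<delta>) * (1 - (602 / 100) * \<delta>) \<le> (1 - \<delta>)\<^sup>2 * (1 - (602 / 100) * \<delta>)"
    using \<delta> d2 by (intro mult_right_mono) (auto simp: power2_eq_square algebra_simps)
  moreover have "(1 - 2 * \<delta>) * (1 - (602 / 100) * \<delta>) = 1 - (802 / 100) * \<delta> + (1204 / 100) * (\<delta> * \<delta>)"
    by (simp add: field_simps)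
  ultimately show "1 - 13 * \<delta> < F" using b(1) d2 \<delta> by linarith
qed

lemma expectation_pmf_of_set_Icc:
  fixes f :: "nat \<Rightarrow> real"
  assumes "1 \<le> m"
  shows "measure_pmf.expectation (pmf_of_set {1..m}) f = (\<Sum>i\<in>{1..m}. f i) / m"
  using assms by (simp add: integral_pmf_of_set)

definition vote_error ::
  "'i set \<Rightarrow> ('i \<Rightarrow> 'u \<Rightarrow> complex) \<Rightarrow> ('i \<Rightarrow> complex) \<Rightarrow> nat \<Rightarrow> real \<Rightarrow> ('i \<times> complex) list list \<Rightarrow> 'u \<Rightarrow> bool" where
  "vote_error J \<Psi> z n \<sigma> cs x \<longleftrightarrow>
     majority (\<lambda>xs. \<sigma> \<le> cmod (block \<Psi> x xs - of_nat n * lin J \<Psi> z x)) cs"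

text \<open>The tolerance is \<delta> times the threshold, so squaring turns the uncertainty of the
  vote into the relative factors \<open>(1 + \<delta>)^2\<close> and \<open>(1 - \<delta>)^2\<close>
  that the layer comparison expects.\<close>

lemma vote_level:
  assumes \<delta>: "0 < \<delta>" "\<delta> < 1" and t: "0 \<le> t" and n: "0 < n"
    and ok: "\<not> vote_error J \<Psi> z n (n * (\<delta> * sqrt t)) cs x"
  shows "t * (1 + \<delta>)\<^sup>2 \<le> (cmod (lin J \<Psi> z x))\<^sup>2 \<Longrightarrow> vote \<Psi> (n * sqrt t) cs x"
    and "vote \<Psi> (n * sqrt t) cs x \<Longrightarrow> t * (1 - \<delta>)\<^sup>2 \<le> (cmod (lin J \<Psi> z x))\<^sup>2"
proof -
  note vc = vote_correct[OF ok[unfolded vote_error_def], of "n * sqrt t"]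
  have eqs: "n * sqrt t + n * (\<delta> * sqrt t) = n * (sqrt t * (1 + \<delta>))"
    "n * sqrt t - n * (\<delta> * sqrt t) = n * (sqrt t * (1 - \<delta>))"
    "cmod (of_nat n * lin J \<Psi> z x) = n * cmod (lin J \<Psi> z x)"
    by (simp_all add: algebra_simps norm_mult)
  have sq: "t * c\<^sup>2 = (sqrt t * c)\<^sup>2" for c
    using t by (simp add: power_mult_distrib)
  show "vote \<Psi> (n * sqrt t) cs x" if "t * (1 + \<delta>)\<^sup>2 \<le> (cmod (lin J \<Psi> z x))\<^sup>2"
  proof (rule vc(1))
    have "sqrt t * (1 + \<delta>) \<le> cmod (lin J \<Psi> z x)"
      using that unfolding sq by (rule power2_le_imp_le) simp
    then show "n * sqrt t + n * (\<delta> * sqrt t) \<le> cmod (of_nat n * lin J \<Psi> z x)"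
      unfolding eqs by (intro mult_left_mono) auto
  qed
  show "t * (1 - \<delta>)\<^sup>2 \<le> (cmod (lin J \<Psi> z x))\<^sup>2" if "vote \<Psi> (n * sqrt t) cs x"
  proof -
    have "sqrt t * (1 - \<delta>) \<le> cmod (lin J \<Psi> z x)"
      using vc(2)[OF that] n unfolding eqs by simp
    then show ?thesis unfolding sq using \<delta> t by (intro power_mono) auto
  qed
qed

text \<open>The deterministic core, for one fixed sample and one fixed z. The codes are chosen in
  the proof with knowledge of both, and therefore concentration is assumed for every code at every
  level. The layer comparison is applied twice, with the same codes.\<close>

lemma rip_of_concentrated_votes:
  fixes \<Psi> :: "'i \<Rightarrow> 'u \<Rightarrow> complex" and n :: "nat \<Rightarrow> nat"
    and m q L :: nat and y :: "nat \<Rightarrow> 'u"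
  assumes \<delta>: "0 < \<delta>" "\<delta> < 1 / 13" and \<rho>: "prob_space \<rho>" and J: "finite J" and m: "1 \<le> m"
    and on: "orthonormal_system \<rho> J \<Psi>"
    and K: "level \<delta> L \<le> K" "K < level \<delta> (Suc L)"
    and y: "\<And>i. i \<in> {1..m} \<Longrightarrow> y i \<in> space \<rho>"
    and unit: "(\<Sum>\<nu>\<in>J. (cmod (z \<nu>))\<^sup>2) = 1"
    and b1: "AE x in \<rho>. (\<Sum>\<nu>\<in>vec_supp J z. (cmod (\<Psi> \<nu> x))\<^sup>2) \<le> K"
    and b2: "\<And>i. i \<in> {1..m} \<Longrightarrow> (\<Sum>\<nu>\<in>vec_supp J z. (cmod (\<Psi> \<nu> (y i)))\<^sup>2) \<le> K"
    and n: "\<And>j. 324 * K \<le> real (n j) * (\<delta>\<^sup>2 * level \<delta> j)" "\<And>j. 0 < n j"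
    and q: "K * (2 * (1 / 3) ^ q) \<le> \<delta> / 100"
    and conc: "\<And>j cs. j \<le> L \<Longrightarrow> cs \<in> codes J (n j) q \<Longrightarrow>
       \<bar>(\<Sum>i\<in>{1..m}. indicator {x \<in> space \<rho>. vote \<Psi> (n j * sqrt (level \<delta> j)) cs x} (y i))
         - m * measure \<rho> {x \<in> space \<rho>. vote \<Psi> (n j * sqrt (level \<delta> j)) cs x}\<bar>
       < m * (\<delta> * measure \<rho> {x \<in> space \<rho>. vote \<Psi> (n j * sqrt (level \<delta> j)) cs x} + u j)"
    and u: "(\<Sum>j\<le>L. level_inc \<delta> j * u j) \<le> \<delta>"
  shows "1 - 13 * \<delta> < (\<Sum>i\<in>{1..m}. (cmod (lin J \<Psi> z (y i)))\<^sup>2) / m"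
    and "(\<Sum>i\<in>{1..m}. (cmod (lin J \<Psi> z (y i)))\<^sup>2) / m < 1 + 13 * \<delta>"
proof -
  interpret \<rho>: prob_space \<rho> by fact
  \<comment> \<open>The empirical measure is placed on the indices and not on the points
    \<open>y i\<close>: coinciding sample points then need no care, and every function is
    measurable.\<close>
  define Q where "Q = pmf_of_set {1..m}"
  have setQ: "set_pmf Q = {1..m}" unfolding Q_def using m by (intro set_pmf_of_set) auto
  have Q: "prob_space (measure_pmf Q)" by (rule measure_pmf.prob_space_axioms)
  have EQ: "measure_pmf.expectation Q f = (\<Sum>i\<in>{1..m}. f i) / m" for f :: "nat \<Rightarrow> real"
    unfolding Q_def by (rule expectation_pmf_of_set_Icc[OF m])
  define \<Phi> where "\<Phi> \<nu> i = \<Psi> \<nu> (y i)" for \<nu> i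
  have linP: "lin J \<Phi> z i = lin J \<Psi> z (y i)" for i by (simp add: lin_def \<Phi>_def)
  have blockP: "block \<Phi> i xs = block \<Psi> (y i) xs" for i xs by (simp add: block_def \<Phi>_def)
  have voteP: "vote \<Phi> \<theta> cs i = vote \<Psi> \<theta> cs (y i)" for \<theta> cs i by (simp add: vote_def blockP)
  have mPsi: "\<Psi> \<nu> \<in> borel_measurable \<rho>" if "\<nu> \<in> J" for \<nu> using on that by (simp add: orthonormal_system_def)
  define \<sigma> where "\<sigma> j = n j * (\<delta> * sqrt (level \<delta> j))" for j
  define \<theta> where "\<theta> j = n j * sqrt (level \<delta> j)" for j
  have t: "0 < level \<delta> j" for j using level_pos[OF \<delta>(1)] .
  have ex: "\<exists>cs. cs \<in> codes J (n j) q
      \<and> measure \<rho> {x \<in> space \<rho>. vote_error J \<Psi> z (n j) (\<sigma> j) cs x} \<le> 2 * (1 / 3) ^ q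
      \<and> measure Q {i \<in> space Q. vote_error J \<Phi> z (n j) (\<sigma> j) cs i} \<le> 2 * (1 / 3) ^ q" for j
  proof -
    have s: "0 < \<sigma> j" using n(2) \<delta> t by (simp add: \<sigma>_def)
    have "(\<sigma> j)\<^sup>2 = real (n j) * (real (n j) * (\<delta>\<^sup>2 * level \<delta> j))"
      using t[of j] by (simp add: \<sigma>_def power_mult_distrib power2_eq_square)
    also have "\<dots> \<ge> real (n j) * (324 * K)" using n(1) by (intro mult_left_mono) auto
    finally have s2: "324 * (real (n j) * K) \<le> (\<sigma> j)\<^sup>2" by simp
    have bQ: "AE i in measure_pmf Q. (\<Sum>\<nu>\<in>vec_supp J z. (cmod (\<Phi> \<nu> i))\<^sup>2) \<le> K"
      using b2 by (simp add: AE_measure_pmf_iff setQ \<Phi>_def)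
    have mPhi: "\<Phi> \<nu> \<in> borel_measurable (measure_pmf Q)" if "\<nu> \<in> J" for \<nu> by simp
    show ?thesis
      unfolding vote_error_def
      using good_code_exists[OF J unit \<rho> Q mPsi mPhi b1 bQ s s2, where q = q] by blast
  qed
  have "\<exists>cs. \<forall>j. cs j \<in> codes J (n j) q
      \<and> measure \<rho> {x \<in> space \<rho>. vote_error J \<Psi> z (n j) (\<sigma> j) (cs j) x} \<le> 2 * (1 / 3) ^ q
      \<and> measure Q {i \<in> space Q. vote_error J \<Phi> z (n j) (\<sigma> j) (cs j) i} \<le> 2 * (1 / 3) ^ q"
    by (rule choice) (rule allI, rule ex)
  then obtain cs where cs: "\<And>j. cs j \<in> codes J (n j) q"
    "\<And>j. measure \<rho> {x \<in> space \<rho>. vote_error J \<Psi> z (n j) (\<sigma> j) (cs j) x} \<le> 2 * (1 / 3) ^ q"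
    "\<And>j. measure Q {i \<in> space Q. vote_error J \<Phi> z (n j) (\<sigma> j) (cs j) i} \<le> 2 * (1 / 3) ^ q"
    by blast
  define G where "G = (\<Sum>j\<le>L. level_inc \<delta> j * measure \<rho> {x \<in> space \<rho>. vote \<Psi> (\<theta> j) (cs j) x})"
  define G' where "G' = (\<Sum>j\<le>L. level_inc \<delta> j * measure Q {i \<in> space Q. vote \<Phi> (\<theta> j) (cs j) i})"
  have d1: "\<delta> < 1" using \<delta> by simp
  have A: "(1 - \<delta>)\<^sup>2 * (G - K * (2 * (1 / 3) ^ q)) \<le> (LINT x|\<rho>. (cmod (lin J \<Psi> z x))\<^sup>2)"
    "(LINT x|\<rho>. (cmod (lin J \<Psi> z x))\<^sup>2) \<le> (1 + \<delta>)\<^sup>2 * ((1 + \<delta>) * (G + K * (2 * (1 / 3) ^ q)) + \<delta>)"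
  proof -
    have mb: "Measurable.pred \<rho> (vote_error J \<Psi> z (n j) (\<sigma> j) (cs j))" for j
      unfolding vote_error_def using cs(1) mPsi
      by (intro measurable_majority_block[of J]) (auto intro!: measurable_lin borel_measurable_times)
    have mh: "Measurable.pred \<rho> (vote \<Psi> (\<theta> j) (cs j))" for j
      using mPsi cs(1) by (rule measurable_vote)
    have bd: "AE x in \<rho>. (cmod (lin J \<Psi> z x))\<^sup>2 \<le> K"
      using b1 by eventually_elim (use cmod_lin_le[OF J, of \<Psi> z] unit order_trans in fastforce)
    have vl: "level \<delta> j * (1 + \<delta>)\<^sup>2 \<le> (cmod (lin J \<Psi> z x))\<^sup>2 \<Longrightarrow> vote \<Psi> (\<theta> j) (cs j) x"
      "vote \<Psi> (\<theta> j) (cs j) x \<Longrightarrow> level \<delta> j * (1 - \<delta>)\<^sup>2 \<le> (cmod (lin J \<Psi> z x))\<^sup>2"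
      if "\<not> vote_error J \<Psi> z (n j) (\<sigma> j) (cs j) x" for j x
      using vote_level[OF \<delta>(1) d1 less_imp_le[OF t[of j]] n(2)[of j] that[unfolded \<sigma>_def]]
      unfolding \<theta>_def by blast+
    note lc = \<rho>.layer_compare[OF \<delta>(1) d1 orthonormal_parseval(1)[OF on J] _ bd K, where h = "\<lambda>j. vote \<Psi> (\<theta> j) (cs j)"
        and b = "\<lambda>j. vote_error J \<Psi> z (n j) (\<sigma> j) (cs j)" and \<eta> = "2 * (1 / 3) ^ q", OF _ mh mb vl]
    show "(1 - \<delta>)\<^sup>2 * (G - K * (2 * (1 / 3) ^ q)) \<le> (LINT x|\<rho>. (cmod (lin J \<Psi> z x))\<^sup>2)"
      unfolding G_def by (rule lc(1)) (use cs(2) in auto)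
    show "(LINT x|\<rho>. (cmod (lin J \<Psi> z x))\<^sup>2) \<le> (1 + \<delta>)\<^sup>2 * ((1 + \<delta>) * (G + K * (2 * (1 / 3) ^ q)) + \<delta>)"
      unfolding G_def by (rule lc(2)) (use cs(2) in auto)
  qed
  have B: "(1 - \<delta>)\<^sup>2 * (G' - K * (2 * (1 / 3) ^ q)) \<le> measure_pmf.expectation Q (\<lambda>i. (cmod (lin J \<Phi> z i))\<^sup>2)"
    "measure_pmf.expectation Q (\<lambda>i. (cmod (lin J \<Phi> z i))\<^sup>2) \<le> (1 + \<delta>)\<^sup>2 * ((1 + \<delta>) * (G' + K * (2 * (1 / 3) ^ q)) + \<delta>)"
  proof -
    have int: "integrable (measure_pmf Q) (\<lambda>i. (cmod (lin J \<Phi> z i))\<^sup>2)"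
      by (rule integrable_measure_pmf_finite) (simp add: setQ)
    have bd: "AE i in measure_pmf Q. (cmod (lin J \<Phi> z i))\<^sup>2 \<le> K"
      using b2 cmod_lin_le[OF J, of \<Phi> z] unit order_trans
      by (fastforce simp: AE_measure_pmf_iff setQ \<Phi>_def)
    have vl: "level \<delta> j * (1 + \<delta>)\<^sup>2 \<le> (cmod (lin J \<Phi> z x))\<^sup>2 \<Longrightarrow> vote \<Phi> (\<theta> j) (cs j) x"
      "vote \<Phi> (\<theta> j) (cs j) x \<Longrightarrow> level \<delta> j * (1 - \<delta>)\<^sup>2 \<le> (cmod (lin J \<Phi> z x))\<^sup>2"
      if "\<not> vote_error J \<Phi> z (n j) (\<sigma> j) (cs j) x" for j x
      using vote_level[OF \<delta>(1) d1 less_imp_le[OF t[of j]] n(2)[of j] that[unfolded \<sigma>_def]]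
      unfolding \<theta>_def by blast+
    note lc = measure_pmf.layer_compare[OF \<delta>(1) d1 int _ bd K, where h = "\<lambda>j. vote \<Phi> (\<theta> j) (cs j)"
        and b = "\<lambda>j. vote_error J \<Phi> z (n j) (\<sigma> j) (cs j)" and \<eta> = "2 * (1 / 3) ^ q", OF _ _ _ vl]
    show "(1 - \<delta>)\<^sup>2 * (G' - K * (2 * (1 / 3) ^ q)) \<le> measure_pmf.expectation Q (\<lambda>i. (cmod (lin J \<Phi> z i))\<^sup>2)"
      unfolding G'_def by (rule lc(1)) (use cs(3) in auto)
    show "measure_pmf.expectation Q (\<lambda>i. (cmod (lin J \<Phi> z i))\<^sup>2) \<le> (1 + \<delta>)\<^sup>2 * ((1 + \<delta>) * (G' + K * (2 * (1 / 3) ^ q)) + \<delta>)"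
      unfolding G'_def by (rule lc(2)) (use cs(3) in auto)
  qed
  \<comment> \<open>The only point where the empirical measure is compared with \<rho>. Weighted by
    the increments, the relative errors add up to \<open>\<delta> * G\<close> and the absolute ones
    to at most \<delta>.\<close>
  have C: "\<bar>G' - G\<bar> \<le> \<delta> * G + \<delta>"
  proof -
    let ?p = "\<lambda>j. measure \<rho> {x \<in> space \<rho>. vote \<Psi> (\<theta> j) (cs j) x}"
    let ?p' = "\<lambda>j. measure Q {i \<in> space Q. vote \<Phi> (\<theta> j) (cs j) i}"
    have diff: "\<bar>?p' j - ?p j\<bar> \<le> \<delta> * ?p j + u j" if "j \<le> L" for j
    proof -
      have "?p' j = measure_pmf.expectation Q (indicator {i. vote \<Phi> (\<theta> j) (cs j) i})" by simp
      also have "\<dots> = (\<Sum>i\<in>{1..m}. indicator {i. vote \<Phi> (\<theta> j) (cs j) i} i) / m" by (rule EQ)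
      also have "(\<Sum>i\<in>{1..m}. indicator {i. vote \<Phi> (\<theta> j) (cs j) i} i :: real)
        = (\<Sum>i\<in>{1..m}. indicator {x \<in> space \<rho>. vote \<Psi> (\<theta> j) (cs j) x} (y i))"
        using y by (intro sum.cong refl) (auto simp: indicator_def voteP)
      finally have eq: "(\<Sum>i\<in>{1..m}. indicator {x \<in> space \<rho>. vote \<Psi> (\<theta> j) (cs j) x} (y i)) = m * ?p' j"
        using m by simp
      have "\<bar>m * ?p' j - m * ?p j\<bar> < m * (\<delta> * ?p j + u j)"
        using conc[OF that cs(1)] unfolding eq[unfolded \<theta>_def] \<theta>_def .
      also have "\<bar>m * ?p' j - m * ?p j\<bar> = m * \<bar>?p' j - ?p j\<bar>"
        by (simp add: abs_mult flip: right_diff_distrib)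
      finally show ?thesis using m by simp
    qed
    have "\<bar>G' - G\<bar> = \<bar>\<Sum>j\<le>L. level_inc \<delta> j * (?p' j - ?p j)\<bar>"
      by (simp add: G_def G'_def right_diff_distrib sum_subtractf)
    also have "\<dots> \<le> (\<Sum>j\<le>L. \<bar>level_inc \<delta> j * (?p' j - ?p j)\<bar>)" by (rule sum_abs)
    also have "\<dots> \<le> (\<Sum>j\<le>L. level_inc \<delta> j * (\<delta> * ?p j + u j))"
      using diff level_inc_nonneg[OF \<delta>(1)] by (intro sum_mono) (auto simp: abs_mult intro!: mult_left_mono)
    also have "\<dots> = \<delta> * G + (\<Sum>j\<le>L. level_inc \<delta> j * u j)"
      by (simp add: G_def distrib_left sum.distrib sum_distrib_left ac_simps)
    finally show ?thesis using u by simp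
  qed
  have K0: "0 \<le> K * (2 * (1 / 3) ^ q)" using K(1) t[of L] by simp
  have P: "(LINT x|\<rho>. (cmod (lin J \<Psi> z x))\<^sup>2) = 1" using orthonormal_parseval(2)[OF on J, of z] unit by simp
  have E: "measure_pmf.expectation Q (\<lambda>i. (cmod (lin J \<Phi> z i))\<^sup>2) = (\<Sum>i\<in>{1..m}. (cmod (lin J \<Psi> z (y i)))\<^sup>2) / m"
    unfolding EQ linP ..
  note fa = two_sided_layer_bounds_arith[OF \<delta> K0 q A[unfolded P] B[unfolded E] C]
  show "1 - 13 * \<delta> < (\<Sum>i\<in>{1..m}. (cmod (lin J \<Psi> z (y i)))\<^sup>2) / m" by (rule fa(1))
  show "(\<Sum>i\<in>{1..m}. (cmod (lin J \<Psi> z (y i)))\<^sup>2) / m < 1 + 13 * \<delta>" by (rule fa(2))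
qed

section \<open>Sample size\<close>

lemma level_bracket:
  assumes \<delta>: "0 < \<delta>" and K: "\<delta> \<le> K"
  obtains L where "level \<delta> L \<le> K" "K < level \<delta> (Suc L)"
proof -
  obtain n where "K / \<delta> < (1 + \<delta>) ^ n"
    using real_arch_pow[of "1 + \<delta>" "K / \<delta>"] \<delta> by auto
  then have ex: "K < level \<delta> n" using \<delta> by (simp add: level_def divide_less_eq mult.commute)
  define k where "k = (LEAST n. K < level \<delta> n)"
  have k: "K < level \<delta> k" unfolding k_def using ex by (rule LeastI)
  have "k \<noteq> 0"
  proof
    assume "k = 0"
    with k K show False by (simp add: level_def)
  qed
  then obtain L where L: "k = Suc L" by (cases k) auto
  have "\<not> K < level \<delta> L" using not_less_Least[of L "\<lambda>n. K < level \<delta> n"] L by (simp add: k_def)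
  then show ?thesis using that[of L] k L by simp
qed

lemma ln_one_plus_ge: "0 < \<delta> \<Longrightarrow> \<delta> / (1 + \<delta>) \<le> ln (1 + \<delta> :: real)"
  using ln_le_minus_one[of "1 / (1 + \<delta>)"] by (simp add: ln_div field_simps)

text \<open>The levels grow geometrically, so their number is of order
  \<open>ln (K / \<delta>) / \<delta>\<close>.\<close>

lemma level_index_le:
  assumes \<delta>: "0 < \<delta>" and "level \<delta> L \<le> K"
  shows "real L * (\<delta> / (1 + \<delta>)) \<le> ln (K / \<delta>)"
proof -
  have "real L * (\<delta> / (1 + \<delta>)) \<le> real L * ln (1 + \<delta>)"
    using ln_one_plus_ge[OF \<delta>] by (intro mult_left_mono) auto
  also have "\<dots> = ln ((1 + \<delta>) ^ L)" using \<delta> by (simp add: ln_realpow)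
  also have "\<dots> \<le> ln (K / \<delta>)"
    using assms by (intro ln_mono) (auto simp: level_def le_divide_eq mult.commute)
  finally show ?thesis .
qed

text \<open>Every increment after the first is the fixed fraction
  \<open>\<delta> / (1 + \<delta>)\<close> of its level, so an error inversely proportional to the
  level costs the same at each of them.\<close>

lemma sum_level_inc_div:
  assumes "0 < \<delta>"
  shows "(\<Sum>j\<le>L. level_inc \<delta> j * (c / level \<delta> j)) = c * (1 + real L * (\<delta> / (1 + \<delta>)))"
proof (induction L)
  case 0
  then show ?case using assms by (simp add: level_def level_inc_def)
next
  case (Suc L)
  have "level_inc \<delta> (Suc L) * (c / level \<delta> (Suc L)) = c * (\<delta> / (1 + \<delta>))"
  proof -
    have cancel: "\<delta> * l * (c / (e * l)) = c * (\<delta> / e)" if "e \<noteq> 0" "l \<noteq> 0" for e l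
      using that by (simp add: field_simps)
    have "level_inc \<delta> (Suc L) = \<delta> * level \<delta> L" by (simp add: level_inc_def level_Suc algebra_simps)
    then show ?thesis
      using cancel[of "1 + \<delta>" "level \<delta> L"] assms level_pos[OF assms, of L] by (simp add: level_Suc)
  qed
  then show ?case using Suc by (simp add: algebra_simps add_divide_distrib)
qed

text \<open>The Chernoff exponent \<open>\<delta> * u j * m\<close> has to exceed the logarithm of
  the number of codes, about \<open>2 * n j * q * ln (4 * N)\<close>, plus a confidence term. The
  choices of n and u make j enter only through the factor \<open>K / level \<delta> j\<close>, which
  is at least 1 for \<open>j \<le> L\<close>.\<close>

lemma sample_size:
  fixes \<delta> \<gamma> K :: real and m N :: nat
  assumes \<delta>: "0 < \<delta>" "\<delta> < 1 / 13" and \<gamma>: "0 < \<gamma>" "\<gamma> < 1" and K: "1 \<le> K" and N: "1 \<le> N"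
    and m: "real m \<ge> 2 ^ 6 * exp 1 * (K / \<delta>\<^sup>2) * ln (K / \<delta>\<^sup>2) *
           max (2 ^ 5 / \<delta> ^ 4 * ln (40 * (K / \<delta>\<^sup>2) * ln (K / \<delta>\<^sup>2)) * ln (4 * real N))
               (1 / \<delta> * ln (1 / (\<gamma> * \<delta>) * ln (K / \<delta>\<^sup>2)))"
  obtains L q :: nat and n :: "nat \<Rightarrow> nat" and u :: "nat \<Rightarrow> real"
  where "1 \<le> m" "level \<delta> L \<le> K" "K < level \<delta> (Suc L)"
    and "\<And>j. 324 * K \<le> real (n j) * (\<delta>\<^sup>2 * level \<delta> j)" "\<And>j. 0 < n j"
    and "K * (2 * (1 / 3) ^ q) \<le> \<delta> / 100"
    and "(\<Sum>j\<le>L. level_inc \<delta> j * u j) \<le> \<delta>"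
    and "(\<Sum>j\<le>L. real ((4 * N) ^ (2 * (n j * q))) * (2 * exp (- (\<delta> * u j * real m)))) < \<gamma>"
proof -
  define X where "X = K / \<delta>\<^sup>2"
  define \<Lambda> where "\<Lambda> = ln X"
  define Q where "Q = ln (40 * X * \<Lambda>)"
  define P where "P = ln (4 * real N)"
  define B where "B = 1 / (\<gamma> * \<delta>) * \<Lambda>"
  have e3: "exp 1 \<le> (3::real)" by (rule exp_le)
  have exp_nat: "exp (real k) \<le> 3 ^ k" for k
    using power_mono[OF e3, of k] by (simp add: exp_of_nat_mult[of k 1, simplified, symmetric])
  have d2: "\<delta>\<^sup>2 \<le> 1 / 169" "0 < \<delta>\<^sup>2"
    using power_mono[of \<delta> "1 / 13" 2] \<delta> by (auto simp: power2_eq_square)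
  have d21: "\<delta>\<^sup>2 \<le> \<delta>" using \<delta> by (simp add: power2_eq_square mult_le_cancel_left1)
  have X: "169 \<le> X"
    unfolding X_def using K d2 by (simp add: le_divide_eq)
  have "exp 4 \<le> X" using exp_nat[of 4] X by simp
  then have \<Lambda>4: "4 \<le> \<Lambda>" unfolding \<Lambda>_def using X by (simp add: ln_ge_iff)
  have XL: "676 \<le> X * \<Lambda>" using mult_mono[of 169 X 4 \<Lambda>] X \<Lambda>4 by simp
  have "exp 1 \<le> 40 * X * \<Lambda>" using e3 XL by linarith
  then have Q1: "1 \<le> Q" unfolding Q_def using XL by (subst ln_ge_iff) auto
  have "exp 1 \<le> 4 * real N" using e3 N by linarith
  then have P1: "1 \<le> P" unfolding P_def using N by (subst ln_ge_iff) auto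
  have gd: "\<gamma> * \<delta> \<le> 1" using \<gamma> \<delta> mult_mono[of \<gamma> 1 \<delta> 1] by simp
  have "4 \<le> \<Lambda> / (\<gamma> * \<delta>)" using gd \<Lambda>4 \<gamma> \<delta>
    by (subst le_divide_eq) (auto intro: order_trans[of "4 * (\<gamma> * \<delta>)" 4 \<Lambda>])
  then have B4: "4 \<le> B" by (simp add: B_def)
  then have lnB: "0 \<le> ln B" by simp
  have lnX: "\<Lambda> = ln (K / \<delta>) + ln (1 / \<delta>)"
    unfolding \<Lambda>_def X_def using \<delta> K
    by (subst ln_mult_pos[symmetric]) (auto simp: power2_eq_square)
  have "exp 1 \<le> 1 / \<delta>" using e3 \<delta> by (intro order_trans[OF e3]) (simp add: le_divide_eq)
  then have "1 \<le> ln (1 / \<delta>)" using \<delta> by (subst ln_ge_iff) auto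
  then have lnK: "1 + ln (K / \<delta>) \<le> \<Lambda>" using lnX by simp
  obtain L where L: "level \<delta> L \<le> K" "K < level \<delta> (Suc L)"
    using level_bracket[of \<delta> K] \<delta> K by auto
  define x where "x j = K / (\<delta>\<^sup>2 * level \<delta> j)" for j
  \<comment> \<open>324 is the constant demanded by Chebyshev's inequality for the blocks. As
    \<open>x j \<ge> 1\<close> for \<open>j \<le> L\<close>, rounding up raises it to 325 at
    most.\<close>
  define n where "n j = nat \<lceil>324 * x j\<rceil>" for j
  \<comment> \<open>Since \<open>exp 1 \<le> 3\<close>, this makes \<open>3 ^ q\<close> at least
    \<open>exp Q = 40 * X * \<Lambda>\<close>, and the bad sets then cost at most
    \<open>\<delta>^2 / (20 * \<Lambda>)\<close>.\<close>
  define q where "q = nat \<lceil>Q\<rceil>"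
  \<comment> \<open>Summed against the increments this gives at most
    \<open>\<delta> / \<Lambda> * (1 + ln (K / \<delta>))\<close>. The bracket is at most \<Lambda>,
    because \<open>\<Lambda> = ln (K / \<delta>) + ln (1 / \<delta>)\<close> and the last term is at
    least 1.\<close>
  define u where "u j = (\<delta> / \<Lambda>) / level \<delta> j" for j
  have t: "0 < level \<delta> j" for j by (rule level_pos[OF \<delta>(1)])
  have xpos: "0 < x j" for j using K d2 t[of j] by (simp add: x_def)
  have n_ge: "324 * x j \<le> n j" for j unfolding n_def by linarith
  have c1: "324 * K \<le> real (n j) * (\<delta>\<^sup>2 * level \<delta> j)" for j
  proof -
    have "324 * K = 324 * x j * (\<delta>\<^sup>2 * level \<delta> j)" using t[of j] d2 \<delta> by (simp add: x_def)
    also have "\<dots> \<le> real (n j) * (\<delta>\<^sup>2 * level \<delta> j)"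
      using n_ge[of j] t[of j] by (intro mult_right_mono) auto
    finally show ?thesis .
  qed
  have c2: "0 < n j" for j using n_ge[of j] xpos[of j] by (simp add: n_def)
  have c3: "K * (2 * (1 / 3) ^ q) \<le> \<delta> / 100"
  proof -
    have "40 * X * \<Lambda> = exp Q" unfolding Q_def using XL by simp
    also have "\<dots> \<le> exp (real q)" unfolding q_def by (simp add: real_nat_ceiling_ge)
    also have "\<dots> \<le> 3 ^ q" by (rule exp_nat)
    finally have "K * 2 / 3 ^ q \<le> K * 2 / (40 * X * \<Lambda>)"
      using K XL by (intro divide_left_mono) auto
    also have "\<dots> = \<delta>\<^sup>2 / (20 * \<Lambda>)" using K \<delta> \<Lambda>4 by (simp add: X_def field_simps)
    also have "\<dots> \<le> \<delta>\<^sup>2 / (20 * 4)" using \<Lambda>4 by (intro divide_left_mono) auto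
    also have "\<dots> \<le> \<delta> / 100"
      using \<delta> d21 mult_left_mono[of \<delta> "1/13" \<delta>] by (simp add: power2_eq_square)
    finally show ?thesis by (simp add: power_one_over field_simps)
  qed
  have c4: "(\<Sum>j\<le>L. level_inc \<delta> j * u j) \<le> \<delta>"
  proof -
    have "(\<Sum>j\<le>L. level_inc \<delta> j * u j) = \<delta> / \<Lambda> * (1 + real L * (\<delta> / (1 + \<delta>)))"
      unfolding u_def by (rule sum_level_inc_div[OF \<delta>(1)])
    also have "\<dots> \<le> \<delta> / \<Lambda> * \<Lambda>"
      using level_index_le[OF \<delta>(1) L(1)] lnK \<delta> \<Lambda>4 by (intro mult_left_mono) auto
    finally show ?thesis using \<Lambda>4 by simp
  qed
  define a where "a = 2 ^ 5 / \<delta> ^ 4 * Q * P"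
  define b where "b = 1 / \<delta> * ln B"
  have a0: "0 < a" using Q1 P1 \<delta> by (simp add: a_def)
  have b_ge: "ln B \<le> b" using lnB \<delta> by (simp add: b_def le_divide_eq mult_left_le)
  have b0: "0 \<le> b" using lnB b_ge by linarith
  have m': "64 * exp 1 * X * \<Lambda> * max a b \<le> m"
    using m unfolding a_def b_def X_def[symmetric] \<Lambda>_def[symmetric] Q_def[symmetric] P_def[symmetric] B_def[symmetric]
    by simp
  have e2: "2 \<le> exp (1::real)" using exp_ge_add_one_self[of 1] by simp
  \<comment> \<open>A maximum is at least half of the sum, and the factor
    \<open>exp 1 \<ge> 2\<close> pays for the half. Entropy and confidence thus obtain separate
    shares a and b.\<close>
  have m2: "64 * (X * \<Lambda>) * (a + b) \<le> m"
  proof -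
    have "64 * (X * \<Lambda>) * (a + b) \<le> 64 * (X * \<Lambda>) * (2 * max a b)"
      using XL by (intro mult_left_mono) auto
    also have "\<dots> \<le> 64 * (X * \<Lambda>) * (exp 1 * max a b)"
      using XL e2 a0 by (intro mult_left_mono mult_right_mono) auto
    finally show ?thesis using m' by (simp add: ac_simps)
  qed
  have "0 < 64 * (X * \<Lambda>) * (a + b)" using X \<Lambda>4 a0 b0 by (intro mult_pos_pos) auto
  then have m1: "1 \<le> m" using m2 by (cases m) auto
  have term_le: "real ((4 * N) ^ (2 * (n j * q))) * (2 * exp (- (\<delta> * u j * real m))) \<le> 2 / B\<^sup>2"
    if "j \<le> L" for j
  proof -
    have "level \<delta> j \<le> level \<delta> L" unfolding level_def
      using \<delta> that by (intro mult_left_mono power_increasing) auto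
    then have tK: "level \<delta> j \<le> K" using L(1) by simp
    then have Kt: "1 \<le> K / level \<delta> j" using t[of j] by simp
    have xK: "x j = K / level \<delta> j / \<delta>\<^sup>2" by (simp add: x_def field_simps)
    have "1 \<le> x j"
      unfolding xK using Kt d2 by (subst le_divide_eq) (auto intro: order_trans)
    then have n_le: "n j \<le> 325 * x j" unfolding n_def by linarith
    have q_le: "q \<le> 2 * Q" unfolding q_def using Q1 by linarith
    have nq: "real (n j) * real q \<le> (325 * x j) * (2 * Q)"
      using n_le q_le xpos[of j] by (intro mult_mono) auto
    have "2 * (real (n j) * real q) * P \<le> 2 * ((325 * x j) * (2 * Q)) * P"
      by (intro mult_right_mono mult_left_mono nq) (use P1 in auto)
    also have "\<dots> = 1300 * (x j * (Q * P))" by simp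
    \<comment> \<open>\<open>1300 = 2 * 325 * 2\<close>, from the exponent 2, the rounded block
      length and \<open>q \<le> 2 * Q\<close>. The new factor completes \<open>x j * (Q * P)\<close>
      to \<open>64 * (K / level \<delta> j) * a\<close>.\<close>
    also have "\<dots> \<le> 64 * 32 / \<delta>\<^sup>2 * (x j * (Q * P))"
    proof (rule mult_right_mono)
      show "1300 \<le> 64 * 32 / \<delta>\<^sup>2" using d2 by (simp add: le_divide_eq)
    qed (use xpos[of j] Q1 P1 in auto)
    also have "\<dots> = 64 * (K / level \<delta> j) * a"
      using \<delta> t[of j] by (simp add: a_def xK power2_eq_square power4_eq_xxxx)
    finally have count: "2 * (real (n j) * real q) * P \<le> 64 * (K / level \<delta> j) * a" .
    \<comment> \<open>Twice \<open>ln B\<close>, because \<open>2 / B\<close> summed over up to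
      \<open>2 * \<Lambda> / \<delta>\<close> levels would only be bounded by
      \<open>4 * \<gamma>\<close>; the square leaves
      \<open>4 * \<gamma>^2 * \<delta> / \<Lambda>\<close>.\<close>
    have "2 * ln B \<le> 64 * 1 * b" using b_ge lnB by linarith
    also have "\<dots> \<le> 64 * (K / level \<delta> j) * b"
      using Kt b0 by (intro mult_right_mono mult_left_mono) auto
    finally have conf: "2 * ln B \<le> 64 * (K / level \<delta> j) * b" .
    have "64 * (K / level \<delta> j) * (a + b) = \<delta> * u j * (64 * (X * \<Lambda>) * (a + b))"
      using \<delta> \<Lambda>4 t[of j] by (simp add: u_def X_def power2_eq_square)
    also have "\<dots> \<le> \<delta> * u j * m"
      using m2 \<delta> \<Lambda>4 t[of j] by (intro mult_left_mono) (auto simp: u_def)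
    finally have expo: "2 * (real (n j) * real q) * P + 2 * ln B \<le> \<delta> * u j * m"
      using count conf by (simp add: distrib_left)
    have "real ((4 * N) ^ (2 * (n j * q))) = exp (2 * (real (n j) * real q) * P)"
    proof -
      have "exp (2 * (real (n j) * real q) * P) = exp (real (2 * (n j * q)) * P)" by simp
      also have "\<dots> = exp P ^ (2 * (n j * q))" by (rule exp_of_nat_mult)
      also have "exp P = real (4 * N)" unfolding P_def using N by simp
      finally show ?thesis by simp
    qed
    moreover have "exp e * (2 * exp (- c)) = 2 * exp (e - c)" for e c :: real
      by (simp add: exp_diff exp_minus divide_inverse)
    ultimately have "real ((4 * N) ^ (2 * (n j * q))) * (2 * exp (- (\<delta> * u j * real m)))
       = 2 * exp (2 * (real (n j) * real q) * P - \<delta> * u j * m)"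
      by simp
    also have "\<dots> \<le> 2 * exp (- (2 * ln B))" using expo by simp
    also have "\<dots> = 2 / B\<^sup>2"
    proof -
      have "exp (2 * ln B) = B\<^sup>2" unfolding exp_double using B4 by simp
      then show ?thesis by (simp add: exp_minus divide_inverse)
    qed
    finally show ?thesis .
  qed
  have c5: "(\<Sum>j\<le>L. real ((4 * N) ^ (2 * (n j * q))) * (2 * exp (- (\<delta> * u j * real m)))) < \<gamma>"
  proof -
    have "real L * (\<delta> / (1 + \<delta>)) \<le> \<Lambda> - 1" using level_index_le[OF \<delta>(1) L(1)] lnK by linarith
    then have "real L * \<delta> \<le> (\<Lambda> - 1) * (1 + \<delta>)" using \<delta> by (simp add: pos_divide_le_eq)
    also have "\<dots> \<le> 2 * \<Lambda> - \<delta>"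
    proof -
      have "\<Lambda> * \<delta> \<le> \<Lambda> * 1" using \<delta> \<Lambda>4 by (intro mult_left_mono) auto
      then show ?thesis using \<delta> by (simp add: algebra_simps)
    qed
    finally have L_le: "real L + 1 \<le> 2 * \<Lambda> / \<delta>" using \<delta> by (simp add: le_divide_eq algebra_simps)
    have "(\<Sum>j\<le>L. real ((4 * N) ^ (2 * (n j * q))) * (2 * exp (- (\<delta> * u j * real m)))) \<le> (\<Sum>j\<le>L. 2 / B\<^sup>2)"
      by (intro sum_mono term_le) simp
    also have "\<dots> = (real L + 1) * (2 / B\<^sup>2)" by simp
    also have "\<dots> \<le> 2 * \<Lambda> / \<delta> * (2 / B\<^sup>2)" using L_le by (intro mult_right_mono) auto
    also have "\<dots> = 4 * \<gamma>\<^sup>2 * \<delta> / \<Lambda>"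
      using \<gamma> \<delta> \<Lambda>4 by (simp add: B_def field_simps power2_eq_square)
    also have "\<dots> \<le> 4 * \<gamma>\<^sup>2 * \<delta> / 4" using \<Lambda>4 \<delta> by (intro divide_left_mono) auto
    also have "\<dots> = \<gamma> * (\<gamma> * \<delta>)" by (simp add: power2_eq_square)
    also have "\<dots> < \<gamma> * 1"
    proof (rule mult_strict_left_mono)
      have "\<gamma> * \<delta> \<le> 1 * \<delta>" using \<gamma> \<delta> by (intro mult_right_mono) auto
      then show "\<gamma> * \<delta> < 1" using \<delta> by linarith
    qed (use \<gamma> in auto)
    finally show ?thesis by simp
  qed
  show ?thesis by (rule that[OF m1 L c1 c2 c3 c4 c5])
qed

section \<open>The constants of the system and the sampling matrix\<close>

text \<open>Boundedness makes the essential supremum a finite number, so the conversion to a real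
  loses nothing and does not fall back to the default 0.\<close>

lemma (in prob_space) Linf_norm_bounded:
  fixes f :: "'a \<Rightarrow> real"
  assumes [measurable]: "f \<in> borel_measurable M" and bd: "\<And>x. x \<in> space M \<Longrightarrow> \<bar>f x\<bar> \<le> C"
  shows AE_le_Linf_norm: "AE x in M. \<bar>f x\<bar> \<le> Linf_norm M f"
    and Linf_norm_le: "AE x in M. \<bar>f x\<bar> \<le> c \<Longrightarrow> Linf_norm M f \<le> c"
proof -
  let ?e = "esssup M (\<lambda>x. ereal \<bar>f x\<bar>)"
  have meas: "(\<lambda>x. ereal \<bar>f x\<bar>) \<in> borel_measurable M" by measurable
  have up: "?e \<le> ereal C" using bd by (intro esssup_I[OF meas]) (auto intro!: AE_I2)
  have lo: "0 \<le> ?e"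
  proof -
    \<comment> \<open>The statement does not depend on x; on a probability space it then holds
      outright.\<close>
    have "AE x in M. 0 \<le> ?e"
      using esssup_AE[of "\<lambda>x. ereal \<bar>f x\<bar>" M]
      by eventually_elim (rule order_trans[rotated], assumption, simp)
    then show ?thesis by simp
  qed
  have fin: "ereal (Linf_norm M f) = ?e"
    unfolding Linf_norm_def using up lo by (cases ?e) auto
  show "AE x in M. \<bar>f x\<bar> \<le> Linf_norm M f"
    using esssup_AE[of "\<lambda>x. ereal \<bar>f x\<bar>" M] unfolding fin[symmetric] by simp
  show "Linf_norm M f \<le> c" if "AE x in M. \<bar>f x\<bar> \<le> c"
  proof -
    have "?e \<le> ereal c" using that by (intro esssup_I[OF meas]) simp
    then show ?thesis unfolding fin[symmetric] by simp
  qed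
qed

context prob_space
begin

context
  fixes J :: "'i set" and \<Psi> :: "'i \<Rightarrow> 'a \<Rightarrow> complex"
  assumes J: "finite J" and on: "orthonormal_system M J \<Psi>"
    and bd: "\<And>\<nu>. \<nu> \<in> J \<Longrightarrow> bounded (\<Psi> \<nu> ` space M)"
begin

lemma sum_cmod_bounded:
  assumes "S \<subseteq> J"
  shows "(\<lambda>x. \<Sum>\<nu>\<in>S. (cmod (\<Psi> \<nu> x))\<^sup>2) \<in> borel_measurable M"
    and "\<exists>C. \<forall>x\<in>space M. \<bar>\<Sum>\<nu>\<in>S. (cmod (\<Psi> \<nu> x))\<^sup>2\<bar> \<le> C"
proof -
  show "(\<lambda>x. \<Sum>\<nu>\<in>S. (cmod (\<Psi> \<nu> x))\<^sup>2) \<in> borel_measurable M"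
    using on assms by (intro borel_measurable_sum borel_measurable_power measurable_compose[OF _ borel_measurable_norm])
      (auto simp: orthonormal_system_def)
  have "\<exists>B. \<forall>\<nu>\<in>J. \<forall>x\<in>space M. cmod (\<Psi> \<nu> x) \<le> B \<nu>"
  proof -
    have "\<forall>\<nu>\<in>J. \<exists>b. \<forall>x\<in>space M. cmod (\<Psi> \<nu> x) \<le> b"
      using bd by (force simp: bounded_iff)
    then show ?thesis by (rule bchoice)
  qed
  then obtain B where B: "\<And>\<nu> x. \<nu> \<in> J \<Longrightarrow> x \<in> space M \<Longrightarrow> cmod (\<Psi> \<nu> x) \<le> B \<nu>" by blast
  have "\<bar>\<Sum>\<nu>\<in>S. (cmod (\<Psi> \<nu> x))\<^sup>2\<bar> \<le> (\<Sum>\<nu>\<in>S. (B \<nu>)\<^sup>2)" if "x \<in> space M" for x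
  proof -
    have "\<bar>\<Sum>\<nu>\<in>S. (cmod (\<Psi> \<nu> x))\<^sup>2\<bar> = (\<Sum>\<nu>\<in>S. (cmod (\<Psi> \<nu> x))\<^sup>2)" by (simp add: sum_nonneg)
    also have "\<dots> \<le> (\<Sum>\<nu>\<in>S. (B \<nu>)\<^sup>2)"
      using B that assms by (intro sum_mono power_mono) auto
    finally show ?thesis .
  qed
  then show "\<exists>C. \<forall>x\<in>space M. \<bar>\<Sum>\<nu>\<in>S. (cmod (\<Psi> \<nu> x))\<^sup>2\<bar> \<le> C" by blast
qed

lemma AE_le_K_set:
  assumes "S \<subseteq> J"
  shows "AE x in M. (\<Sum>\<nu>\<in>S. (cmod (\<Psi> \<nu> x))\<^sup>2) \<le> K_set M \<Psi> S"
proof -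
  obtain C where C: "\<And>x. x \<in> space M \<Longrightarrow> \<bar>\<Sum>\<nu>\<in>S. (cmod (\<Psi> \<nu> x))\<^sup>2\<bar> \<le> C"
    using sum_cmod_bounded(2)[OF assms] by blast
  have "AE x in M. \<bar>\<Sum>\<nu>\<in>S. (cmod (\<Psi> \<nu> x))\<^sup>2\<bar> \<le> K_set M \<Psi> S"
    unfolding K_set_def by (rule AE_le_Linf_norm[OF sum_cmod_bounded(1)[OF assms]]) (rule C)
  then show ?thesis by eventually_elim simp
qed

text \<open>It makes the family of admissible supports closed under subsets, as the measurability of
  the event requires.\<close>

lemma K_set_mono:
  assumes "S \<subseteq> T" "T \<subseteq> J"
  shows "K_set M \<Psi> S \<le> K_set M \<Psi> T"
proof -
  have SJ: "S \<subseteq> J" using assms by simp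
  obtain C where C: "\<And>x. x \<in> space M \<Longrightarrow> \<bar>\<Sum>\<nu>\<in>S. (cmod (\<Psi> \<nu> x))\<^sup>2\<bar> \<le> C"
    using sum_cmod_bounded(2)[OF SJ] by blast
  show ?thesis
    unfolding K_set_def[of M \<Psi> S]
  proof (rule Linf_norm_le[OF sum_cmod_bounded(1)[OF SJ]])
    show "\<bar>\<Sum>\<nu>\<in>S. (cmod (\<Psi> \<nu> x))\<^sup>2\<bar> \<le> C" if "x \<in> space M" for x
      using that by (rule C)
    show "AE x in M. \<bar>\<Sum>\<nu>\<in>S. (cmod (\<Psi> \<nu> x))\<^sup>2\<bar> \<le> K_set M \<Psi> T"
      using AE_le_K_set[OF assms(2)]
    proof eventually_elim
      case (elim x)
      have "(\<Sum>\<nu>\<in>S. (cmod (\<Psi> \<nu> x))\<^sup>2) \<le> (\<Sum>\<nu>\<in>T. (cmod (\<Psi> \<nu> x))\<^sup>2)"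
        using assms finite_subset[OF assms(2) J] by (intro sum_mono2) auto
      then show ?case using elim by (simp add: sum_nonneg)
    qed
  qed
qed

text \<open>Each \<open>|\<Psi> \<nu>|^2\<close> integrates to 1, and a mean is at most the
  essential supremum. This supplies \<open>1 \<le> K\<close>, so that the logarithms in the sample
  size are positive.\<close>

lemma card_le_K_set:
  assumes "S \<subseteq> J"
  shows "real (card S) \<le> K_set M \<Psi> S"
proof -
  have sq: "(LINT x|M. (cmod (\<Psi> \<nu> x))\<^sup>2) = 1" "integrable M (\<lambda>x. (cmod (\<Psi> \<nu> x))\<^sup>2)" if "\<nu> \<in> J" for \<nu>
  proof -
    have "complex_of_real (LINT x|M. (cmod (\<Psi> \<nu> x))\<^sup>2) = (LINT x|M. \<Psi> \<nu> x * cnj (\<Psi> \<nu> x))"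
      unfolding integral_complex_of_real[symmetric] by (simp only: complex_norm_square)
    also have "\<dots> = 1" using on that by (simp add: orthonormal_system_def)
    finally show "(LINT x|M. (cmod (\<Psi> \<nu> x))\<^sup>2) = 1" by simp
    show "integrable M (\<lambda>x. (cmod (\<Psi> \<nu> x))\<^sup>2)" using on that by (simp add: orthonormal_system_def)
  qed
  have "real (card S) = (\<Sum>\<nu>\<in>S. LINT x|M. (cmod (\<Psi> \<nu> x))\<^sup>2)"
    using sq(1) assms by (simp add: subset_iff)
  also have "\<dots> = (LINT x|M. (\<Sum>\<nu>\<in>S. (cmod (\<Psi> \<nu> x))\<^sup>2))"
    using sq(2) assms by (intro Bochner_Integration.integral_sum[symmetric]) auto
  also have "\<dots> \<le> (LINT x|M. K_set M \<Psi> S)"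
    using sq(2) assms AE_le_K_set[OF assms]
    by (intro integral_mono_AE Bochner_Integration.integrable_sum) auto
  finally show ?thesis by (simp add: prob_space)
qed

end

end

section \<open>The sampling matrix and the isometry event\<close>

lemma l2_norm_sampling:
  "(l2_norm {1..m} (mat_vec J (sampling_matrix \<Psi> m y) z))\<^sup>2 = (\<Sum>i\<in>{1..m}. (cmod (lin J \<Psi> z (y i)))\<^sup>2) / m"
proof -
  have "mat_vec J (sampling_matrix \<Psi> m y) z i = lin J \<Psi> z (y i) / of_real (sqrt m)" for i
    by (simp add: mat_vec_def sampling_matrix_def lin_def sum_divide_distrib)
  then have "(cmod (mat_vec J (sampling_matrix \<Psi> m y) z i))\<^sup>2 = (cmod (lin J \<Psi> z (y i)))\<^sup>2 / m" for i
    by (simp add: norm_divide power_divide)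
  then show ?thesis
    by (simp add: l2_norm_def L2_set_def sum_nonneg sum_divide_distrib)
qed

lemma l2_norm_sq_norm: "(l2_norm J z)\<^sup>2 = sq_norm J z"
  by (simp add: l2_norm_def L2_set_def sq_norm_def sum_nonneg)

lemma lin_scale: "lin J \<Psi> (\<lambda>\<nu>. c * z \<nu>) x = c * lin J \<Psi> z x"
  by (simp add: lin_def sum_distrib_left ac_simps)

lemma continuous_on_cmod_lin: "continuous_on UNIV (\<lambda>z. (cmod (lin J \<Psi> z x))\<^sup>2)"
  unfolding lin_def
  by (intro continuous_on_power continuous_on_norm continuous_on_sum continuous_on_mult
      continuous_on_const continuous_on_product_coordinates)

text \<open>As P passes to subsets, every vector supported on an admissible S is itself admissible.
  The event is therefore a finite intersection, over the admissible S, of the positive definiteness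
  of two forms on a coordinate subspace.\<close>

lemma sets_rip_event:
  assumes J: "finite J"
    and P: "\<And>S T. S \<subseteq> T \<Longrightarrow> T \<subseteq> J \<Longrightarrow> P T \<Longrightarrow> P S"
    and meas: "\<And>i \<nu>. i \<in> {1..m} \<Longrightarrow> \<nu> \<in> J \<Longrightarrow> (\<lambda>\<omega>. \<Psi> \<nu> (y i \<omega>)) \<in> borel_measurable M"
  shows "{\<omega> \<in> space M. \<forall>z. vec_supp J z \<noteq> {} \<and> P (vec_supp J z) \<longrightarrow>
      c1 * sq_norm J z < (\<Sum>i\<in>{1..m}. (cmod (lin J \<Psi> z (y i \<omega>)))\<^sup>2) / real m \<and>
      (\<Sum>i\<in>{1..m}. (cmod (lin J \<Psi> z (y i \<omega>)))\<^sup>2) / real m < c2 * sq_norm J z} \<in> sets M"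
proof -
  define F where "F \<omega> z = (\<Sum>i\<in>{1..m}. (cmod (lin J \<Psi> z (y i \<omega>)))\<^sup>2) / real m" for \<omega> z
  have mF: "(\<lambda>\<omega>. F \<omega> z) \<in> borel_measurable M" for z
    unfolding F_def lin_def using meas
    by (intro borel_measurable_divide borel_measurable_sum borel_measurable_power measurable_compose[OF _ borel_measurable_norm]
        borel_measurable_times borel_measurable_const) auto
  have cF: "continuous_on UNIV (F \<omega>)" for \<omega>
    unfolding F_def divide_inverse
    by (intro continuous_on_mult continuous_on_sum continuous_on_cmod_lin continuous_on_const)
  have sF: "F \<omega> (\<lambda>\<nu>. of_real c * z \<nu>) = c\<^sup>2 * F \<omega> z" for \<omega> c z
    by (simp add: F_def lin_scale norm_mult power_mult_distrib sum_distrib_left)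
  have pos: "{\<omega> \<in> space M. \<forall>z. supported_on S z \<and> z \<noteq> (\<lambda>_. 0) \<longrightarrow> 0 < g \<omega> z} \<in> sets M"
    if "S \<subseteq> J" "g = (\<lambda>\<omega> z. F \<omega> z - c1 * sq_norm J z) \<or> g = (\<lambda>\<omega> z. c2 * sq_norm J z - F \<omega> z)" for S g
  proof (rule sets_positive_definite)
    show "finite S" using J that(1) by (rule rev_finite_subset)
    show "(\<lambda>\<omega>. g \<omega> z) \<in> borel_measurable M" for z
      using that(2) mF by (auto intro!: borel_measurable_diff)
    show "continuous_on UNIV (g \<omega>)" for \<omega>
      using that(2) by (auto intro!: continuous_on_diff continuous_on_mult cF continuous_on_sq_norm)
    show "g \<omega> (\<lambda>\<nu>. of_real c * z \<nu>) = c\<^sup>2 * g \<omega> z" for \<omega> c z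
      using that(2) by (auto simp: sF sq_norm_scale algebra_simps)
  qed
  let ?Q = "\<lambda>S \<omega>. (\<forall>z. supported_on S z \<and> z \<noteq> (\<lambda>_. 0) \<longrightarrow> 0 < F \<omega> z - c1 * sq_norm J z) \<and>
      (\<forall>z. supported_on S z \<and> z \<noteq> (\<lambda>_. 0) \<longrightarrow> 0 < c2 * sq_norm J z - F \<omega> z)"
  have iff: "(\<forall>z. vec_supp J z \<noteq> {} \<and> P (vec_supp J z) \<longrightarrow> c1 * sq_norm J z < F \<omega> z \<and> F \<omega> z < c2 * sq_norm J z)
     \<longleftrightarrow> (\<forall>S\<in>{S. S \<subseteq> J \<and> P S}. ?Q S \<omega>)" for \<omega>
  proof
    assume *: "\<forall>z. vec_supp J z \<noteq> {} \<and> P (vec_supp J z) \<longrightarrow> c1 * sq_norm J z < F \<omega> z \<and> F \<omega> z < c2 * sq_norm J z"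
    have "c1 * sq_norm J z < F \<omega> z \<and> F \<omega> z < c2 * sq_norm J z"
      if "S \<subseteq> J" "P S" "supported_on S z" "z \<noteq> (\<lambda>_. 0)" for S z
    proof -
      have "vec_supp J z \<subseteq> S" using that(3) by (auto simp: vec_supp_def supported_on_def)
      then have "P (vec_supp J z)" using P that(1,2) by blast
      moreover have "vec_supp J z \<noteq> {}"
        using that(1,3,4) by (auto simp: vec_supp_def supported_on_def fun_eq_iff)
      ultimately show ?thesis using * by blast
    qed
    then show "\<forall>S\<in>{S. S \<subseteq> J \<and> P S}. ?Q S \<omega>" by auto
  next
    assume *: "\<forall>S\<in>{S. S \<subseteq> J \<and> P S}. ?Q S \<omega>"
    show "\<forall>z. vec_supp J z \<noteq> {} \<and> P (vec_supp J z) \<longrightarrow> c1 * sq_norm J z < F \<omega> z \<and> F \<omega> z < c2 * sq_norm J z"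
    proof (intro allI impI)
      fix z assume z: "vec_supp J z \<noteq> {} \<and> P (vec_supp J z)"
      \<comment> \<open>Values of z outside J are arbitrary; cutting them off changes neither side
        and yields a vector that is \<open>supported_on\<close> its support.\<close>
      define z' where "z' \<nu> = (if \<nu> \<in> vec_supp J z then z \<nu> else 0)" for \<nu>
      have eq: "z' \<nu> = z \<nu>" if "\<nu> \<in> J" for \<nu> using that by (simp add: z'_def vec_supp_def)
      have same: "sq_norm J z' = sq_norm J z" "F \<omega> z' = F \<omega> z"
        unfolding sq_norm_def F_def lin_def using eq by (simp_all cong: sum.cong)
      have z': "supported_on (vec_supp J z) z' \<and> z' \<noteq> (\<lambda>_. 0)"
        using z by (auto simp: supported_on_def z'_def fun_eq_iff vec_supp_def)
      have "vec_supp J z \<in> {S. S \<subseteq> J \<and> P S}" using z by (auto simp: vec_supp_def)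
      with * have Q: "?Q (vec_supp J z) \<omega>" by (rule bspec)
      show "c1 * sq_norm J z < F \<omega> z \<and> F \<omega> z < c2 * sq_norm J z"
        using conjunct1[OF Q, THEN spec, THEN mp, OF z'] conjunct2[OF Q, THEN spec, THEN mp, OF z']
        unfolding same by simp
    qed
  qed
  have "{\<omega> \<in> space M. \<forall>z. vec_supp J z \<noteq> {} \<and> P (vec_supp J z) \<longrightarrow>
      c1 * sq_norm J z < F \<omega> z \<and> F \<omega> z < c2 * sq_norm J z} = {\<omega> \<in> space M. \<forall>S\<in>{S. S \<subseteq> J \<and> P S}. ?Q S \<omega>}"
    by (simp only: iff)
  also have "\<dots> \<in> sets M"
  proof (intro sets.sets_Collect_finite_All sets.sets_Collect_conj)
    show "finite {S. S \<subseteq> J \<and> P S}" using J by simp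
  qed (rule pos, simp, simp)+
  finally show ?thesis unfolding F_def .
qed

text \<open>The union runs over levels and codes and mentions no z: uniformity in z comes from here,
  although the code used for a given z depends on the sample.\<close>

lemma (in prob_space) prob_not_concentrated:
  fixes \<Psi> :: "'i \<Rightarrow> 'u \<Rightarrow> complex" and n :: "nat \<Rightarrow> nat" and m q L :: nat and u \<theta> :: "nat \<Rightarrow> real"
  assumes indep: "indep_vars (\<lambda>_. \<rho>) y {1..m}"
    and distr: "\<And>i. i \<in> {1..m} \<Longrightarrow> distr M \<rho> (y i) = \<rho>"
    and J: "finite J" "J \<noteq> {}" and \<delta>: "0 < \<delta>" "\<delta> \<le> 1"
    and mPsi: "\<And>\<nu>. \<nu> \<in> J \<Longrightarrow> \<Psi> \<nu> \<in> borel_measurable \<rho>"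
  defines "H \<equiv> \<lambda>j cs. {x \<in> space \<rho>. vote \<Psi> (\<theta> j) cs x}"
  defines "D \<equiv> \<lambda>j cs. {\<omega> \<in> space M. m * (\<delta> * measure \<rho> (H j cs) + u j)
      \<le> \<bar>(\<Sum>i\<in>{1..m}. indicator (H j cs) (y i \<omega>)) - m * measure \<rho> (H j cs)\<bar>}"
  shows "(\<Union>j\<le>L. \<Union>cs\<in>codes J (n j) q. D j cs) \<in> events"
    and "prob (\<Union>j\<le>L. \<Union>cs\<in>codes J (n j) q. D j cs)
      \<le> (\<Sum>j\<le>L. real ((4 * card J) ^ (2 * (n j * q))) * (2 * exp (- (\<delta> * u j * m))))"
proof -
  have rv: "y i \<in> measurable M \<rho>" if "i \<in> {1..m}" for i using indep that by (auto simp: indep_vars_def)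
  have H: "H j cs \<in> sets \<rho>" if "cs \<in> codes J (n j) q" for j cs
    using measurable_vote[OF mPsi that] unfolding H_def pred_def by auto
  have D: "D j cs \<in> events" if "cs \<in> codes J (n j) q" for j cs
    unfolding D_def using H[OF that] rv
    by (intro borel_measurable_le borel_measurable_abs borel_measurable_diff borel_measurable_sum borel_measurable_const)
       (rule measurable_compose[OF _ borel_measurable_indicator], auto)
  have DU: "(\<Union>cs\<in>codes J (n j) q. D j cs) \<in> events" for j
    using D finite_codes[OF J(1)] by (intro sets.finite_UN) auto
  then show "(\<Union>j\<le>L. \<Union>cs\<in>codes J (n j) q. D j cs) \<in> events" by (rule sets.finite_UN[rotated]) simp
  have PD: "prob (D j cs) \<le> 2 * exp (- (\<delta> * u j * m))" if "cs \<in> codes J (n j) q" for j cs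
    using relative_chernoff[OF indep _ distr H[OF that] \<delta>, of "u j"] unfolding D_def by simp
  have "prob (\<Union>j\<le>L. \<Union>cs\<in>codes J (n j) q. D j cs) \<le> (\<Sum>j\<le>L. prob (\<Union>cs\<in>codes J (n j) q. D j cs))"
    using DU by (intro finite_measure_subadditive_finite) auto
  also have "\<dots> \<le> (\<Sum>j\<le>L. \<Sum>cs\<in>codes J (n j) q. prob (D j cs))"
    using D finite_codes[OF J(1)] by (intro sum_mono finite_measure_subadditive_finite) auto
  also have "\<dots> \<le> (\<Sum>j\<le>L. \<Sum>cs\<in>codes J (n j) q. 2 * exp (- (\<delta> * u j * m)))"
    using PD by (intro sum_mono)
  also have "\<dots> = (\<Sum>j\<le>L. real (card (codes J (n j) q)) * (2 * exp (- (\<delta> * u j * m))))" by simp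
  also have "\<dots> \<le> (\<Sum>j\<le>L. real ((4 * card J) ^ (2 * (n j * q))) * (2 * exp (- (\<delta> * u j * m))))"
    using card_codes_le[OF J] by (intro sum_mono mult_right_mono) (simp_all only: of_nat_le_iff, simp)
  finally show "prob (\<Union>j\<le>L. \<Union>cs\<in>codes J (n j) q. D j cs)
      \<le> (\<Sum>j\<le>L. real ((4 * card J) ^ (2 * (n j * q))) * (2 * exp (- (\<delta> * u j * m))))" .
qed

theorem theorem3p3:
  fixes \<delta> \<gamma> :: real
    and s m :: nat
    and V :: "'d::finite \<Rightarrow> real set"
    and U :: "(real ^ 'd) set"
    and \<rho> :: "(real ^ 'd) measure"
    and J :: "('d \<Rightarrow> nat) set"
    and \<Psi> :: "('d \<Rightarrow> nat) \<Rightarrow> real ^ 'd \<Rightarrow> complex"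
    and M :: "'w measure"
    and y :: "nat \<Rightarrow> 'w \<Rightarrow> real ^ 'd"
  defines "K \<equiv> K_card \<rho> J \<Psi> s"
    and "N \<equiv> card J"
  assumes "0 < \<delta>" and "\<delta> < 1 / 13" and "0 < \<gamma>" and "\<gamma> < 1" and "1 \<le> s"
    and "U = {x. \<forall>k. x $ k \<in> V k}" and "compact U"
    and "prob_space \<rho>" and "sets \<rho> = sets (restrict_space borel U)"
    and "finite J"
    and "\<exists>\<Lambda>. \<Lambda> \<subseteq> J \<and> lower_set \<Lambda> \<and> card \<Lambda> = s"
    and "orthonormal_system \<rho> J \<Psi>"
    and "\<And>\<nu>. \<nu> \<in> J \<Longrightarrow> bounded (\<Psi> \<nu> ` U)"
    and "real m \<ge> 2 ^ 6 * exp 1 * (K / \<delta>\<^sup>2) * ln (K / \<delta>\<^sup>2) *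
           max (2 ^ 5 / \<delta> ^ 4 * ln (40 * (K / \<delta>\<^sup>2) * ln (K / \<delta>\<^sup>2)) * ln (4 * real N))
               (1 / \<delta> * ln (1 / (\<gamma> * \<delta>) * ln (K / \<delta>\<^sup>2)))"
    and "prob_space M"
    and "prob_space.indep_vars M (\<lambda>_. \<rho>) y {1..m}"
    and "\<And>i. i \<in> {1..m} \<Longrightarrow> distr M \<rho> (y i) = \<rho>"
  defines "A \<equiv> \<lambda>\<omega>. sampling_matrix \<Psi> m (\<lambda>i. y i \<omega>)"
  defines "E \<equiv> {\<omega> \<in> space M. \<forall>z :: ('d \<Rightarrow> nat) \<Rightarrow> complex.
              vec_supp J z \<noteq> {} \<and> K_set \<rho> \<Psi> (vec_supp J z) \<le> K \<longrightarrow>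
                (1 - 13 * \<delta>) * (l2_norm J z)\<^sup>2 < (l2_norm {1..m} (mat_vec J (A \<omega>) z))\<^sup>2 \<and>
                (l2_norm {1..m} (mat_vec J (A \<omega>) z))\<^sup>2 < (1 + 13 * \<delta>) * (l2_norm J z)\<^sup>2}"
  shows "E \<in> sets M \<and> measure M E > 1 - \<gamma>"
proof -
  interpret M: prob_space M by fact
  interpret \<rho>: prob_space \<rho> by fact
  have on: "orthonormal_system \<rho> J \<Psi>" by fact
  have J: "finite J" by fact
  have "space \<rho> = space (restrict_space borel U)" using sets_eq_imp_space_eq assms(11) by blast
  then have space: "space \<rho> = U" by (simp add: space_restrict_space)
  have bd: "bounded (\<Psi> \<nu> ` space \<rho>)" if "\<nu> \<in> J" for \<nu> using assms(15)[OF that] space by simp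
  have mPsi: "\<Psi> \<nu> \<in> borel_measurable \<rho>" if "\<nu> \<in> J" for \<nu> using on that by (simp add: orthonormal_system_def)
  have indep: "M.indep_vars (\<lambda>_. \<rho>) y {1..m}" by fact
  have distr: "distr M \<rho> (y i) = \<rho>" if "i \<in> {1..m}" for i using that by fact
  have rv: "y i \<in> measurable M \<rho>" if "i \<in> {1..m}" for i using indep that by (auto simp: M.indep_vars_def)
  have mono: "K_set \<rho> \<Psi> S \<le> K_set \<rho> \<Psi> T" if "S \<subseteq> T" "T \<subseteq> J" for S T
    by (rule \<rho>.K_set_mono[OF J on bd that])
  have AE_K: "AE x in \<rho>. (\<Sum>\<nu>\<in>S. (cmod (\<Psi> \<nu> x))\<^sup>2) \<le> K_set \<rho> \<Psi> S" if "S \<subseteq> J" for S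
    by (rule \<rho>.AE_le_K_set[OF J on bd that])

  obtain \<Lambda> where \<Lambda>: "\<Lambda> \<subseteq> J" "lower_set \<Lambda>" "card \<Lambda> = s" using assms(13) by blast
  \<comment> \<open>The given lower set of cardinality s shows that the supremum defining K is over
    a nonempty family; this family is also finite, so K is at least
    \<open>s \<ge> 1\<close>.\<close>
  have "real s \<le> K_set \<rho> \<Psi> \<Lambda>" using \<rho>.card_le_K_set[OF J on bd \<Lambda>(1)] \<Lambda>(3) by simp
  also have "\<dots> \<le> K"
    unfolding K_def K_card_def
  proof (rule cSUP_upper)
    have "{\<Lambda>. \<Lambda> \<subseteq> J \<and> lower_set \<Lambda> \<and> card \<Lambda> = s} \<subseteq> Pow J" by blast
    then have "finite {\<Lambda>. \<Lambda> \<subseteq> J \<and> lower_set \<Lambda> \<and> card \<Lambda> = s}" using J by (simp add: finite_subset)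
    then show "bdd_above (K_set \<rho> \<Psi> ` {\<Lambda>. \<Lambda> \<subseteq> J \<and> lower_set \<Lambda> \<and> card \<Lambda> = s})" by simp
  qed (use \<Lambda> in simp)
  finally have K1: "1 \<le> K" using assms(7) by simp
  have J0: "J \<noteq> {}" using \<Lambda> assms(7) by auto
  then have N1: "1 \<le> N" using J by (simp add: N_def Suc_leI card_gt_0_iff)

  have E_eq: "E = {\<omega> \<in> space M. \<forall>z. vec_supp J z \<noteq> {} \<and> K_set \<rho> \<Psi> (vec_supp J z) \<le> K \<longrightarrow>
      (1 - 13 * \<delta>) * sq_norm J z < (\<Sum>i\<in>{1..m}. (cmod (lin J \<Psi> z (y i \<omega>)))\<^sup>2) / real m \<and>
      (\<Sum>i\<in>{1..m}. (cmod (lin J \<Psi> z (y i \<omega>)))\<^sup>2) / real m < (1 + 13 * \<delta>) * sq_norm J z}"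
    unfolding E_def A_def l2_norm_sampling unfolding l2_norm_sq_norm ..
  have E: "E \<in> sets M"
    unfolding E_eq
  proof (rule sets_rip_event[OF J, where P = "\<lambda>S. K_set \<rho> \<Psi> S \<le> K"])
    show "K_set \<rho> \<Psi> S \<le> K" if "S \<subseteq> T" "T \<subseteq> J" "K_set \<rho> \<Psi> T \<le> K" for S T
      using mono[OF that(1,2)] that(3) by simp
    show "(\<lambda>\<omega>. \<Psi> \<nu> (y i \<omega>)) \<in> borel_measurable M" if "i \<in> {1..m}" "\<nu> \<in> J" for i \<nu>
      using measurable_compose[OF rv[OF that(1)] mPsi[OF that(2)]] .
  qed

  obtain L q n u where m1: "1 \<le> m" and L: "level \<delta> L \<le> K" "K < level \<delta> (Suc L)"
    and n: "\<And>j. 324 * K \<le> real (n j) * (\<delta>\<^sup>2 * level \<delta> j)" "\<And>j. 0 < n j"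
    and q: "K * (2 * (1 / 3) ^ q) \<le> \<delta> / 100"
    and u: "(\<Sum>j\<le>L. level_inc \<delta> j * u j) \<le> \<delta>"
    and small: "(\<Sum>j\<le>L. real ((4 * N) ^ (2 * (n j * q))) * (2 * exp (- (\<delta> * u j * real m)))) < \<gamma>"
    by (rule sample_size[OF assms(3-6) K1 N1 assms(16)]) (rule that; assumption)

  define H where "H j cs = {x \<in> space \<rho>. vote \<Psi> (n j * sqrt (level \<delta> j)) cs x}" for j cs
  define D where "D j cs = {\<omega> \<in> space M. m * (\<delta> * measure \<rho> (H j cs) + u j)
      \<le> \<bar>(\<Sum>i\<in>{1..m}. indicator (H j cs) (y i \<omega>)) - m * measure \<rho> (H j cs)\<bar>}" for j cs
  define C where "C = (\<Union>j\<le>L. \<Union>cs\<in>codes J (n j) q. D j cs)"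
  have d1: "\<delta> \<le> 1" using assms(4) by simp
  have C: "C \<in> sets M"
    unfolding C_def D_def H_def
    by (rule M.prob_not_concentrated(1)[OF indep _ J J0 assms(3) d1]) (rule distr mPsi, assumption)+
  have "measure M C \<le> (\<Sum>j\<le>L. real ((4 * N) ^ (2 * (n j * q))) * (2 * exp (- (\<delta> * u j * real m))))"
    unfolding C_def D_def H_def N_def
    by (rule M.prob_not_concentrated(2)[OF indep _ J J0 assms(3) d1]) (rule distr mPsi, assumption)+
  also note small
  finally have PC: "measure M C < \<gamma>" .

  \<comment> \<open>The bound by K holds only almost everywhere, so a sample point may violate it.
    Finitely many indices and supports leave a single null set of samples.\<close>
  have "AE \<omega> in M. \<forall>i\<in>{1..m}. \<forall>S\<in>{S. S \<subseteq> J \<and> K_set \<rho> \<Psi> S \<le> K}. (\<Sum>\<nu>\<in>S. (cmod (\<Psi> \<nu> (y i \<omega>)))\<^sup>2) \<le> K"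
  proof (intro AE_finite_allI)
    show "finite {S. S \<subseteq> J \<and> K_set \<rho> \<Psi> S \<le> K}" using J by simp
    fix i S assume i: "i \<in> {1..m}" and S: "S \<in> {S. S \<subseteq> J \<and> K_set \<rho> \<Psi> S \<le> K}"
    then have SJ: "S \<subseteq> J" by simp
    have "AE x in \<rho>. (\<Sum>\<nu>\<in>S. (cmod (\<Psi> \<nu> x))\<^sup>2) \<le> K"
      using AE_K[OF SJ] by eventually_elim (use S in simp)
    then have "AE x in distr M \<rho> (y i). (\<Sum>\<nu>\<in>S. (cmod (\<Psi> \<nu> x))\<^sup>2) \<le> K"
      by (simp only: distr[OF i])
    then show "AE \<omega> in M. (\<Sum>\<nu>\<in>S. (cmod (\<Psi> \<nu> (y i \<omega>)))\<^sup>2) \<le> K"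
      by (rule AE_distrD[OF rv[OF i]])
  qed simp
  \<comment> \<open>Because of this null set the complement of C is contained in E only almost
    surely, which suffices for comparing probabilities.\<close>
  then have "AE \<omega> in M. \<omega> \<in> space M - C \<longrightarrow> \<omega> \<in> E"
  proof eventually_elim
    case (elim \<omega>)
    show ?case
    proof
      assume \<omega>: "\<omega> \<in> space M - C"
      have ys: "y i \<omega> \<in> space \<rho>" if "i \<in> {1..m}" for i
        using \<omega> measurable_space[OF rv[OF that]] by simp
      have conc: "\<bar>(\<Sum>i\<in>{1..m}. indicator (H j cs) (y i \<omega>)) - m * measure \<rho> (H j cs)\<bar>
         < m * (\<delta> * measure \<rho> (H j cs) + u j)" if "j \<le> L" "cs \<in> codes J (n j) q" for j cs
        using \<omega> that unfolding C_def D_def by (simp add: not_le)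
      have "(1 - 13 * \<delta>) * sq_norm J z < (\<Sum>i\<in>{1..m}. (cmod (lin J \<Psi> z (y i \<omega>)))\<^sup>2) / real m \<and>
        (\<Sum>i\<in>{1..m}. (cmod (lin J \<Psi> z (y i \<omega>)))\<^sup>2) / real m < (1 + 13 * \<delta>) * sq_norm J z"
        if z: "vec_supp J z \<noteq> {}" "K_set \<rho> \<Psi> (vec_supp J z) \<le> K" for z
      proof -
        \<comment> \<open>Both sides are homogeneous of degree 2, and scaling preserves the support,
          so it is enough to treat a unit vector.\<close>
        define r where "r = sqrt (sq_norm J z)"
        have "0 < sq_norm J z"
          using z(1) J unfolding sq_norm_def vec_supp_def by (auto intro: sum_pos2)
        then have r: "0 < r" "r\<^sup>2 = sq_norm J z" by (auto simp: r_def)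
        define w where "w = (\<lambda>\<nu>. of_real (1 / r) * z \<nu>)"
        have supp: "vec_supp J w = vec_supp J z" using r(1) by (simp add: vec_supp_def w_def)
        have sub: "vec_supp J w \<subseteq> J" by (auto simp: vec_supp_def)
        have unit: "(\<Sum>\<nu>\<in>J. (cmod (w \<nu>))\<^sup>2) = 1"
          unfolding sq_norm_def[symmetric] w_def sq_norm_scale using r(1) by (simp add: power_one_over flip: r(2))
        have b1: "AE x in \<rho>. (\<Sum>\<nu>\<in>vec_supp J w. (cmod (\<Psi> \<nu> x))\<^sup>2) \<le> K"
          using AE_K[OF sub] by eventually_elim (use z(2) supp in simp)
        have b2: "(\<Sum>\<nu>\<in>vec_supp J w. (cmod (\<Psi> \<nu> (y i \<omega>)))\<^sup>2) \<le> K" if "i \<in> {1..m}" for i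
          using elim that sub z(2) supp by simp
        note rip = rip_of_concentrated_votes[OF assms(3,4) \<open>prob_space \<rho>\<close> J m1 on L ys unit b1 b2 n q
            conc[unfolded H_def] u]
        have "(\<Sum>i\<in>{1..m}. (cmod (lin J \<Psi> w (y i \<omega>)))\<^sup>2) / m
           = (\<Sum>i\<in>{1..m}. (cmod (lin J \<Psi> z (y i \<omega>)))\<^sup>2) / m / r\<^sup>2"
          unfolding w_def lin_scale using r(1)
          by (simp add: norm_mult norm_divide power_mult_distrib power_divide sum_divide_distrib ac_simps)
        then show ?thesis
          using rip pos_less_divide_eq[of "r\<^sup>2"] pos_divide_less_eq[of "r\<^sup>2"] r(1)
          unfolding r(2)[symmetric] by (simp del: divide_divide_eq_left)
      qed
      then show "\<omega> \<in> E" unfolding E_eq using \<omega> by blast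
    qed
  qed
  then have "measure M (space M - C) \<le> measure M E"
    using E by (intro M.finite_measure_mono_AE) (auto elim: eventually_mono)
  moreover have "measure M (space M - C) = 1 - measure M C" using C by (rule M.prob_compl)
  ultimately show ?thesis using E PC by simp
qed

end
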